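(* Let $\mathcal G$ be a finite connected groupoid, $x\in\mathcal G_0$, $\tau(x)=\{\tau_y\}_{y\in\mathcal G_0}$ a transversal for $x$, $A$ a ring, and $\beta=(B_g,\beta_g)_{g\in\mathcal G}$ the lifted partial action of $\mathcal G$ on $A$ coming from a datum $(I,\gamma_{\tau(x)},\gamma_{(x)})\in\mathcal D_{\tau(x)}(A)$. Assume that $\beta$ is $\tau(x)$-global and $\gamma$-unital, and that $A=\bigoplus_{y\in\mathcal G_0}I_y=\bigoplus_{y\in\mathcal G_0}B_y$. Let $R=A\star_\beta\mathcal G$, $S=B_x\star_{\beta_{(x)}}\mathcal G(x)$ (regarded as a subring of $R$, with identity $1_S=1_x\delta_x$), $U=R1_S$ (an $(R,S)$-bimodule), $V=1_SR$ (an $(S,R)$-bimodule), $\mu:U\otimes_SV\to R$, $u\otimes v\mapsto uv$, and $\nu:V\otimes_RU\to S$, $v\otimes u\mapsto vu$. Then the sixtuple $(A\star_\beta\mathcal G,\ B_x\star_{\beta_{(x)}}\mathcal G(x),\ U,\ V,\ \mu,\ \nu)$ is a Morita context, and $\mu$ and $\nu$ are surjective.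
   Context: Conventions. Rings are associative, not necessarily unital; ideals are two-sided. A groupoid $\mathcal G$ is a small category in which every morphism is invertible; it is identified with its set of morphisms, and its set of objects $\mathcal G_0$ is identified with the set of identity morphisms. For $g\in\mathcal G$, $s(g)=g^{-1}g$ and $t(g)=gg^{-1}$; $gh$ is defined iff $s(g)=t(h)$. Put $\mathcal G(y,z)=\{g: s(g)=y,\ t(g)=z\}$ and $\mathcal G(x)=\mathcal G(x,x)$ (a group). $\mathcal G$ is connected if $\mathcal G(y,z)\neq\emptyset$ for all $y,z\in\mathcal G_0$. A transversal for $x$ is a family $\tau(x)=\{\tau_y: y\in\mathcal G_0\}$ with $\tau_y\in\mathcal G(x,y)$ and $\tau_x=x$. Put $g_x=\tau_{t(g)}^{-1}g\tau_{s(g)}\in\mathcal G(x)$. For partial bijections, $u\circ v$ has domain $v^{-1}(\mathrm{dom}(u)\cap\mathrm{ran}(v))$ and range $u(\mathrm{dom}(u)\cap\mathrm{ran}(v))$. A partial action of a groupoid $\mathcal G$ on a ring $A$ is a family $\alpha=(A_g,\alpha_g)_{g\in\mathcal G}$ where, for each $g$, $A_{t(g)}$ is an ideal of $A$, $A_g$ is an ideal of $A_{t(g)}$, $\alpha_g:A_{g^{-1}}\to A_g$ is a ring isomorphism, $\alpha_y=\mathrm{id}_{A_y}$ for $y\in\mathcal G_0$, and $\alpha_{gh}$ extends $\alpha_g\circ\alpha_h$ whenever $s(g)=t(h)$. A partial action of a group $H$ on a ring $R$ is the one-object case with the ideal attached to the identity equal to $R$; it is unital if each of its ideals is a unital ring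 whose identity is a central idempotent of $R$. The partial action $\alpha$ is $\tau(x)$-global if $A_{\tau_y^{-1}}=A_x$ and $A_{\tau_y}=A_y$ for all $y\in\mathcal G_0$. An object of $\mathcal D_{\tau(x)}(A)$ is a datum $(I,\gamma_{\tau(x)},\gamma_{(x)})$ consisting of: (a) a family $I=\{I_y\}_{y\in\mathcal G_0}$ of ideals of $A$; (b) ring isomorphisms $\gamma_{\tau(x)}=\{\gamma_{\tau_y}:I_{\tau_y^{-1}}\to I_{\tau_y}\}_{y\in\mathcal G_0}$; (c) a partial action $\gamma_{(x)}=(I_h,\gamma_h)_{h\in\mathcal G(x)}$ of the group $\mathcal G(x)$ on $I_x$; such that (d) $\gamma_x=\gamma_{\tau_x}$ is the identity map of $I_x=I_{\tau_x}$; (e) $I_{\tau_y}$ is an ideal of $I_y$ and $I_{\tau_y^{-1}}$ is an ideal of $I_x$ for all $y$; (f) $\gamma_{\tau_{t(g)}}\big(I_{\tau_{t(g)}^{-1}}\cap\gamma_{g_x}(I_{\tau_{s(g)}^{-1}}\cap I_{g_x^{-1}})\big)$ is an ideal of $I_{t(g)}$ for all $g\in\mathcal G$. The lifted partial action coming from it is $\beta=(B_g,\beta_g)_{g\in\mathcal G}$ with $\beta_y=\mathrm{id}_{I_y}$ for $y\in\mathcal G_0$, $\beta_g=\gamma_{\tau_{t(g)}}\circ\gamma_{g_x}\circ\gamma_{\tau_{s(g)}}^{-1}$ for $g\notin\mathcal G_0$ (composition of partial bijections), and $B_g$ the range of $\beta_g$; it is a partial action of $\mathcal G$ on $A$. It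 is called $\gamma$-unital if $I_x$ is a unital ring and $\gamma_{(x)}$ is a unital partial group action. When $\beta$ is $\tau(x)$-global and $\gamma$-unital, $B_g=\gamma_{\tau_{t(g)}}(I_{g_x})=A1_g$ for all $g\in\mathcal G$, where $1_h$ is the identity of $I_h$ for $h\in\mathcal G(x)$ and $1_g=\gamma_{\tau_{t(g)}}(1_{g_x})$ is the identity of $B_g$, a central idempotent of $A$. The restriction $\beta_{(x)}=(B_h,\beta_h)_{h\in\mathcal G(x)}$ is a partial action of $\mathcal G(x)$ on $B_x$; it equals $\gamma_{(x)}$. The partial skew groupoid ring is $A\star_\beta\mathcal G=\bigoplus_{g\in\mathcal G}B_g\delta_g$ ($\delta_g$ placeholder symbols), with multiplication determined by $(a\delta_g)(b\delta_h)=a\beta_g(b1_{g^{-1}})\delta_{gh}$ if $s(g)=t(h)$ and $0$ otherwise ($a\in B_g$, $b\in B_h$); its identity is $\sum_{y\in\mathcal G_0}1_y\delta_y$. Similarly $B_x\star_{\beta_{(x)}}\mathcal G(x)=\bigoplus_{h\in\mathcal G(x)}B_h\delta_h$. A Morita context $(R,S,U,V,\mu,\nu)$ consists of unital rings $R,S$, bimodules ${}_RU_S$ and ${}_SV_R$, and bimodule maps $\mu:U\otimes_SV\to R$, $\nu:V\otimes_RU\to S$ such that $u\,\nu(v\otimes u')=\mu(u\otimes v)\,u'$ and $v\,\mu(u\otimes v')=\nu(v\otimes u)\,v'$ for all $u,u'\in U$, $v,v'\in V$. *)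

theory Defs
  imports "HOL-Algebra.Module" "HOL-Algebra.Free_Abelian_Groups" "HOL-Algebra.Generated_Groups"
begin

section \<open>Groupoids\<close>

text \<open>Small categories are given by their set of morphisms; an object is identified with its
  identity morphism. The composite \<open>cmp G g h\<close> is meaningful only if \<open>src G g = tgt G h\<close>.\<close>

record 'g category =
  Mor :: "'g set"
  src :: "'g \<Rightarrow> 'g"
  tgt :: "'g \<Rightarrow> 'g"
  cmp :: "'g \<Rightarrow> 'g \<Rightarrow> 'g"

locale small_category =
  fixes G :: "('g, 'z) category_scheme"
  assumes src_closed: "g \<in> Mor G \<Longrightarrow> src G g \<in> Mor G"
    and tgt_closed: "g \<in> Mor G \<Longrightarrow> tgt G g \<in> Mor G"
    and src_src: "g \<in> Mor G \<Longrightarrow> src G (src G g) = src G g"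
    and tgt_src: "g \<in> Mor G \<Longrightarrow> tgt G (src G g) = src G g"
    and src_tgt: "g \<in> Mor G \<Longrightarrow> src G (tgt G g) = tgt G g"
    and tgt_tgt: "g \<in> Mor G \<Longrightarrow> tgt G (tgt G g) = tgt G g"
    and cmp_closed: "\<lbrakk>g \<in> Mor G; h \<in> Mor G; src G g = tgt G h\<rbrakk> \<Longrightarrow> cmp G g h \<in> Mor G"
    and src_cmp: "\<lbrakk>g \<in> Mor G; h \<in> Mor G; src G g = tgt G h\<rbrakk> \<Longrightarrow> src G (cmp G g h) = src G h"
    and tgt_cmp: "\<lbrakk>g \<in> Mor G; h \<in> Mor G; src G g = tgt G h\<rbrakk> \<Longrightarrow> tgt G (cmp G g h) = tgt G g"
    and cmp_assoc: "\<lbrakk>g \<in> Mor G; h \<in> Mor G; k \<in> Mor G; src G g = tgt G h; src G h = tgt G k\<rbrakk>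
      \<Longrightarrow> cmp G (cmp G g h) k = cmp G g (cmp G h k)"
    and cmp_src: "g \<in> Mor G \<Longrightarrow> cmp G g (src G g) = g"
    and cmp_tgt: "g \<in> Mor G \<Longrightarrow> cmp G (tgt G g) g = g"

definition is_inverse :: "('g, 'z) category_scheme \<Rightarrow> 'g \<Rightarrow> 'g \<Rightarrow> bool" where
  "is_inverse G g h \<longleftrightarrow> h \<in> Mor G \<and> src G h = tgt G g \<and> tgt G h = src G g
     \<and> cmp G h g = src G g \<and> cmp G g h = tgt G g"

locale groupoid = small_category +
  assumes invertible: "g \<in> Mor G \<Longrightarrow> \<exists>h. is_inverse G g h"

definition ginv :: "('g, 'z) category_scheme \<Rightarrow> 'g \<Rightarrow> 'g" where
  "ginv G g = (THE h. is_inverse G g h)"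

definition Obj :: "('g, 'z) category_scheme \<Rightarrow> 'g set" where
  "Obj G = src G ` Mor G"

definition homset :: "('g, 'z) category_scheme \<Rightarrow> 'g \<Rightarrow> 'g \<Rightarrow> 'g set" where
  "homset G y z = {g \<in> Mor G. src G g = y \<and> tgt G g = z}"

text \<open>The group \<open>G(x)\<close>, as a groupoid with the single object \<open>x\<close>.\<close>

definition isotropy :: "('g, 'z) category_scheme \<Rightarrow> 'g \<Rightarrow> ('g, 'z) category_scheme" where
  "isotropy G x = G\<lparr>Mor := homset G x x\<rparr>"

definition connected_groupoid :: "('g, 'z) category_scheme \<Rightarrow> bool" where
  "connected_groupoid G \<longleftrightarrow> groupoid G \<and> (\<forall>y\<in>Obj G. \<forall>z\<in>Obj G. homset G y z \<noteq> {})"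

definition transversal :: "('g, 'z) category_scheme \<Rightarrow> 'g \<Rightarrow> ('g \<Rightarrow> 'g) \<Rightarrow> bool" where
  "transversal G x \<tau> \<longleftrightarrow> (\<forall>y\<in>Obj G. \<tau> y \<in> homset G x y) \<and> \<tau> x = x"

text \<open>The element \<open>g\<^sub>x\<close> of \<open>G(x)\<close>.\<close>

definition to_loop :: "('g, 'z) category_scheme \<Rightarrow> ('g \<Rightarrow> 'g) \<Rightarrow> 'g \<Rightarrow> 'g" where
  "to_loop G \<tau> g = cmp G (cmp G (ginv G (\<tau> (tgt G g))) g) (\<tau> (src G g))"

section \<open>Non-unital rings inside an ambient ring\<close>

text \<open>The type class \<^class>\<open>ring\<close> does not require an identity.\<close>

definition subrng :: "'a::ring set \<Rightarrow> bool" where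
  "subrng J \<longleftrightarrow> 0 \<in> J \<and> (\<forall>a\<in>J. - a \<in> J) \<and> (\<forall>a\<in>J. \<forall>b\<in>J. a + b \<in> J \<and> a * b \<in> J)"

definition ideal_of :: "'a::ring set \<Rightarrow> 'a set \<Rightarrow> bool" where
  "ideal_of I J \<longleftrightarrow> I \<subseteq> J \<and> 0 \<in> I \<and> (\<forall>a\<in>I. - a \<in> I) \<and> (\<forall>a\<in>I. \<forall>b\<in>I. a + b \<in> I)
     \<and> (\<forall>a\<in>I. \<forall>r\<in>J. r * a \<in> I \<and> a * r \<in> I)"

definition is_rng_one :: "'a::ring set \<Rightarrow> 'a \<Rightarrow> bool" where
  "is_rng_one J e \<longleftrightarrow> e \<in> J \<and> (\<forall>a\<in>J. e * a = a \<and> a * e = a)"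

definition unital_rng :: "'a::ring set \<Rightarrow> bool" where
  "unital_rng J \<longleftrightarrow> subrng J \<and> (\<exists>e. is_rng_one J e)"

definition rng_one :: "'a::ring set \<Rightarrow> 'a" where
  "rng_one J = (THE e. is_rng_one J e)"

text \<open>For finite \<open>K\<close>: the ring \<open>A\<close> is the internal direct sum of its ideals \<open>J k\<close>.\<close>

definition internal_direct_sum :: "'a::ring set \<Rightarrow> 'k set \<Rightarrow> ('k \<Rightarrow> 'a set) \<Rightarrow> bool" where
  "internal_direct_sum A K J \<longleftrightarrow> finite K \<and> (\<forall>k\<in>K. ideal_of (J k) A)
     \<and> (\<forall>a\<in>A. \<exists>!f. f \<in> (\<Pi>\<^sub>E k\<in>K. J k) \<and> a = (\<Sum>k\<in>K. f k))"

section \<open>Partial bijections\<close>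

text \<open>Partial bijections are injective maps \<open>'a \<rightharpoonup> 'a\<close>; their composition is \<open>\<circ>\<^sub>m\<close>
  and "\<open>v\<close> extends \<open>u\<close>" is \<open>u \<subseteq>\<^sub>m v\<close>.\<close>

definition pid :: "'a set \<Rightarrow> ('a \<rightharpoonup> 'a)" where
  "pid X = (\<lambda>a. if a \<in> X then Some a else None)"

definition pinv :: "('a \<rightharpoonup> 'b) \<Rightarrow> ('b \<rightharpoonup> 'a)" where
  "pinv f = (\<lambda>b. if b \<in> ran f then Some (THE a. f a = Some b) else None)"

definition pimage :: "('a \<rightharpoonup> 'b) \<Rightarrow> 'a set \<Rightarrow> 'b set" where
  "pimage f X = {b. \<exists>a\<in>X. f a = Some b}"

definition rng_iso :: "'a::ring set \<Rightarrow> 'a set \<Rightarrow> ('a \<rightharpoonup> 'a) \<Rightarrow> bool" where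
  "rng_iso I J f \<longleftrightarrow> subrng I \<and> subrng J \<and> dom f = I \<and> ran f = J \<and> inj_on f I
     \<and> (\<forall>a\<in>I. \<forall>b\<in>I. the (f (a + b)) = the (f a) + the (f b)
                     \<and> the (f (a * b)) = the (f a) * the (f b))"

section \<open>Partial actions\<close>

definition partial_action ::
  "('g, 'z) category_scheme \<Rightarrow> 'a::ring set \<Rightarrow> ('g \<Rightarrow> 'a set) \<Rightarrow> ('g \<Rightarrow> 'a \<rightharpoonup> 'a) \<Rightarrow> bool" where
  "partial_action G A D \<alpha> \<longleftrightarrow> groupoid G \<and> subrng A
     \<and> (\<forall>g\<in>Mor G. ideal_of (D (tgt G g)) A \<and> ideal_of (D g) (D (tgt G g))
          \<and> rng_iso (D (ginv G g)) (D g) (\<alpha> g))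
     \<and> (\<forall>y\<in>Obj G. \<alpha> y = pid (D y))
     \<and> (\<forall>g\<in>Mor G. \<forall>h\<in>Mor G. src G g = tgt G h \<longrightarrow> (\<alpha> g \<circ>\<^sub>m \<alpha> h) \<subseteq>\<^sub>m \<alpha> (cmp G g h))"

definition partial_group_action ::
  "('g, 'z) category_scheme \<Rightarrow> 'a::ring set \<Rightarrow> ('g \<Rightarrow> 'a set) \<Rightarrow> ('g \<Rightarrow> 'a \<rightharpoonup> 'a) \<Rightarrow> bool" where
  "partial_group_action H R D \<alpha> \<longleftrightarrow> partial_action H R D \<alpha> \<and> (\<exists>e. Obj H = {e} \<and> D e = R)"

definition unital_partial_group_action ::
  "('g, 'z) category_scheme \<Rightarrow> 'a::ring set \<Rightarrow> ('g \<Rightarrow> 'a set) \<Rightarrow> ('g \<Rightarrow> 'a \<rightharpoonup> 'a) \<Rightarrow> bool" where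
  "unital_partial_group_action H R D \<alpha> \<longleftrightarrow> partial_group_action H R D \<alpha>
     \<and> (\<forall>h\<in>Mor H. \<exists>e. is_rng_one (D h) e \<and> e * e = e \<and> (\<forall>r\<in>R. e * r = r * e))"

definition tau_global ::
  "('g, 'z) category_scheme \<Rightarrow> 'g \<Rightarrow> ('g \<Rightarrow> 'g) \<Rightarrow> ('g \<Rightarrow> 'a set) \<Rightarrow> bool" where
  "tau_global G x \<tau> D \<longleftrightarrow> (\<forall>y\<in>Obj G. D (ginv G (\<tau> y)) = D x \<and> D (\<tau> y) = D y)"

text \<open>The objects of \<open>\<D>\<^sub>\<tau>\<^sub>(\<^sub>x\<^sub>)(A)\<close>. A single family \<open>I\<close> carries the ideals
  indexed by the objects, by \<open>\<tau> y\<close>, by \<open>(\<tau> y)\<^sup>-\<^sup>1\<close> and by \<open>G(x)\<close>, and a single family \<open>\<gamma>\<close>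
  carries the maps indexed by \<open>\<tau> y\<close> and by \<open>G(x)\<close>: these index sets meet only in \<open>x = \<tau> x\<close>, where
  (c) and (d) make the components agree. All other values of \<open>I\<close> and \<open>\<gamma>\<close> are irrelevant.\<close>

definition tau_datum ::
  "('g, 'z) category_scheme \<Rightarrow> 'g \<Rightarrow> ('g \<Rightarrow> 'g) \<Rightarrow> 'a::ring set
    \<Rightarrow> ('g \<Rightarrow> 'a set) \<Rightarrow> ('g \<Rightarrow> 'a \<rightharpoonup> 'a) \<Rightarrow> bool" where
  "tau_datum G x \<tau> A I \<gamma> \<longleftrightarrow>
     (\<comment> \<open>(a)\<close> \<forall>y\<in>Obj G. ideal_of (I y) A) \<and>
     (\<comment> \<open>(b)\<close> \<forall>y\<in>Obj G. rng_iso (I (ginv G (\<tau> y))) (I (\<tau> y)) (\<gamma> (\<tau> y))) \<and>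
     (\<comment> \<open>(c)\<close> partial_group_action (isotropy G x) (I x) I \<gamma>) \<and>
     (\<comment> \<open>(d)\<close> \<gamma> (\<tau> x) = pid (I x) \<and> I (\<tau> x) = I x) \<and>
     (\<comment> \<open>(e)\<close> \<forall>y\<in>Obj G. ideal_of (I (\<tau> y)) (I y) \<and> ideal_of (I (ginv G (\<tau> y))) (I x)) \<and>
     (\<comment> \<open>(f)\<close> \<forall>g\<in>Mor G. ideal_of
        (pimage (\<gamma> (\<tau> (tgt G g)))
          (I (ginv G (\<tau> (tgt G g))) \<inter>
           pimage (\<gamma> (to_loop G \<tau> g))
             (I (ginv G (\<tau> (src G g))) \<inter> I (ginv G (to_loop G \<tau> g)))))
        (I (tgt G g)))"

definition lifted ::
  "('g, 'z) category_scheme \<Rightarrow> ('g \<Rightarrow> 'g) \<Rightarrow> ('g \<Rightarrow> 'a set) \<Rightarrow> ('g \<Rightarrow> 'a \<rightharpoonup> 'a) \<Rightarrow> 'g \<Rightarrow> 'a \<rightharpoonup> 'a"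
  where
  "lifted G \<tau> I \<gamma> g =
     (if g \<in> Obj G then pid (I g)
      else \<gamma> (\<tau> (tgt G g)) \<circ>\<^sub>m \<gamma> (to_loop G \<tau> g) \<circ>\<^sub>m pinv (\<gamma> (\<tau> (src G g))))"

definition gamma_unital ::
  "('g, 'z) category_scheme \<Rightarrow> 'g \<Rightarrow> ('g \<Rightarrow> 'a::ring set) \<Rightarrow> ('g \<Rightarrow> 'a \<rightharpoonup> 'a) \<Rightarrow> bool" where
  "gamma_unital G x I \<gamma> \<longleftrightarrow>
     unital_rng (I x) \<and> unital_partial_group_action (isotropy G x) (I x) I \<gamma>"

section \<open>Partial skew groupoid rings\<close>

text \<open>An element \<open>\<Sum>g. a\<^sub>g \<delta>\<^sub>g\<close> is the function \<open>g \<mapsto> a\<^sub>g\<close>, extended by \<open>0\<close> outside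
  \<^term>\<open>Mor G\<close>. The product is the biadditive extension of
  \<open>(a \<delta>\<^sub>g)(b \<delta>\<^sub>h) = a \<alpha>\<^sub>g(b 1) \<delta>\<^sub>g\<^sub>h\<close> for \<open>src g = tgt h\<close>, where \<open>1\<close> is
  the identity of the ideal attached to the inverse of \<open>g\<close>. This is
  meaningful if every \<open>D g\<close> has an identity, and \<open>one\<close> is in the carrier if there are
  finitely many objects.\<close>

definition skew_ring ::
  "('g, 'z) category_scheme \<Rightarrow> ('g \<Rightarrow> 'a::ring set) \<Rightarrow> ('g \<Rightarrow> 'a \<rightharpoonup> 'a) \<Rightarrow> ('g \<Rightarrow> 'a) ring" where
  "skew_ring G D \<alpha> =
    \<lparr>carrier = {f. (\<forall>g\<in>Mor G. f g \<in> D g) \<and> (\<forall>g. g \<notin> Mor G \<longrightarrow> f g = 0) \<and> finite {g. f g \<noteq> 0}},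
     monoid.mult = (\<lambda>f f' k. \<Sum>(g, h) \<in> {(g, h). g \<in> Mor G \<and> h \<in> Mor G \<and> f g \<noteq> 0 \<and> f' h \<noteq> 0
                                     \<and> src G g = tgt G h \<and> cmp G g h = k}.
               f g * the (\<alpha> g (f' h * rng_one (D (ginv G g))))),
     one = (\<lambda>g. if g \<in> Obj G then rng_one (D g) else 0),
     ring.zero = (\<lambda>g. 0),
     ring.add = (\<lambda>f f' g. f g + f' g)\<rparr>"

section \<open>Bimodules and tensor products\<close>

text \<open>As for \<^typ>\<open>('a, 'b) module\<close>, the fields \<open>mult\<close> and \<open>one\<close> of a bimodule are
  not used.\<close>

record ('r, 's, 'm) bimodule = "'m ring" +
  lact :: "'r \<Rightarrow> 'm \<Rightarrow> 'm"
  ract :: "'m \<Rightarrow> 's \<Rightarrow> 'm"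

locale bimodule = R?: ring R + S?: ring S + M?: abelian_group M
  for R :: "('r, 'c) ring_scheme" and S :: "('s, 'd) ring_scheme"
    and M :: "('r, 's, 'm, 'e) bimodule_scheme" +
  assumes lact_closed: "\<lbrakk>r \<in> carrier R; m \<in> carrier M\<rbrakk> \<Longrightarrow> lact M r m \<in> carrier M"
    and ract_closed: "\<lbrakk>m \<in> carrier M; s \<in> carrier S\<rbrakk> \<Longrightarrow> ract M m s \<in> carrier M"
    and lact_add_l: "\<lbrakk>r \<in> carrier R; r' \<in> carrier R; m \<in> carrier M\<rbrakk>
      \<Longrightarrow> lact M (r \<oplus>\<^bsub>R\<^esub> r') m = lact M r m \<oplus>\<^bsub>M\<^esub> lact M r' m"
    and lact_add_r: "\<lbrakk>r \<in> carrier R; m \<in> carrier M; m' \<in> carrier M\<rbrakk>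
      \<Longrightarrow> lact M r (m \<oplus>\<^bsub>M\<^esub> m') = lact M r m \<oplus>\<^bsub>M\<^esub> lact M r m'"
    and lact_mult: "\<lbrakk>r \<in> carrier R; r' \<in> carrier R; m \<in> carrier M\<rbrakk>
      \<Longrightarrow> lact M (r \<otimes>\<^bsub>R\<^esub> r') m = lact M r (lact M r' m)"
    and lact_one: "m \<in> carrier M \<Longrightarrow> lact M \<one>\<^bsub>R\<^esub> m = m"
    and ract_add_l: "\<lbrakk>m \<in> carrier M; m' \<in> carrier M; s \<in> carrier S\<rbrakk>
      \<Longrightarrow> ract M (m \<oplus>\<^bsub>M\<^esub> m') s = ract M m s \<oplus>\<^bsub>M\<^esub> ract M m' s"
    and ract_add_r: "\<lbrakk>m \<in> carrier M; s \<in> carrier S; s' \<in> carrier S\<rbrakk>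
      \<Longrightarrow> ract M m (s \<oplus>\<^bsub>S\<^esub> s') = ract M m s \<oplus>\<^bsub>M\<^esub> ract M m s'"
    and ract_mult: "\<lbrakk>m \<in> carrier M; s \<in> carrier S; s' \<in> carrier S\<rbrakk>
      \<Longrightarrow> ract M m (s \<otimes>\<^bsub>S\<^esub> s') = ract M (ract M m s) s'"
    and ract_one: "m \<in> carrier M \<Longrightarrow> ract M m \<one>\<^bsub>S\<^esub> = m"
    and lact_ract: "\<lbrakk>r \<in> carrier R; m \<in> carrier M; s \<in> carrier S\<rbrakk>
      \<Longrightarrow> ract M (lact M r m) s = lact M r (ract M m s)"

definition bimodule_hom ::
  "('r, 'c) ring_scheme \<Rightarrow> ('s, 'd) ring_scheme \<Rightarrow> ('r, 's, 'm, 'e) bimodule_scheme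
    \<Rightarrow> ('r, 's, 'n, 'f) bimodule_scheme \<Rightarrow> ('m \<Rightarrow> 'n) \<Rightarrow> bool" where
  "bimodule_hom R S M N f \<longleftrightarrow> bimodule R S M \<and> bimodule R S N
     \<and> f \<in> carrier M \<rightarrow> carrier N
     \<and> (\<forall>m\<in>carrier M. \<forall>m'\<in>carrier M. f (m \<oplus>\<^bsub>M\<^esub> m') = f m \<oplus>\<^bsub>N\<^esub> f m')
     \<and> (\<forall>r\<in>carrier R. \<forall>m\<in>carrier M. f (lact M r m) = lact N r (f m))
     \<and> (\<forall>m\<in>carrier M. \<forall>s\<in>carrier S. f (ract M m s) = ract N (f m) s)"

text \<open>The additive group of a ring \<open>R\<close> restricted to a subset \<open>X\<close>, acted upon from both sides
  by multiplication in \<open>R\<close>.\<close>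

definition sub_bimodule :: "('r, 'c) ring_scheme \<Rightarrow> 'r set \<Rightarrow> ('r, 'r, 'r) bimodule" where
  "sub_bimodule R X = \<lparr>carrier = X, monoid.mult = undefined, one = undefined,
     ring.zero = \<zero>\<^bsub>R\<^esub>, ring.add = ring.add R, lact = monoid.mult R, ract = monoid.mult R\<rparr>"

text \<open>The tensor product over \<open>S\<close>: the free abelian group on pairs, modulo the
  biadditivity and \<open>S\<close>-balance relations.\<close>

definition tensor_relations ::
  "('s, 'd) ring_scheme \<Rightarrow> ('r, 's, 'u, 'e) bimodule_scheme \<Rightarrow> ('s, 't, 'v, 'f) bimodule_scheme
    \<Rightarrow> ('u \<times> 'v \<Rightarrow>\<^sub>0 int) set" where
  "tensor_relations S U V =
     {frag_of (u \<oplus>\<^bsub>U\<^esub> u', v) - frag_of (u, v) - frag_of (u', v) | u u' v.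
        u \<in> carrier U \<and> u' \<in> carrier U \<and> v \<in> carrier V} \<union>
     {frag_of (u, v \<oplus>\<^bsub>V\<^esub> v') - frag_of (u, v) - frag_of (u, v') | u v v'.
        u \<in> carrier U \<and> v \<in> carrier V \<and> v' \<in> carrier V} \<union>
     {frag_of (ract U u s, v) - frag_of (u, lact V s v) | u s v.
        u \<in> carrier U \<and> s \<in> carrier S \<and> v \<in> carrier V}"

abbreviation tensor_free ::
  "('r, 's, 'u, 'e) bimodule_scheme \<Rightarrow> ('s, 't, 'v, 'f) bimodule_scheme
    \<Rightarrow> ('u \<times> 'v \<Rightarrow>\<^sub>0 int) monoid" where
  "tensor_free U V \<equiv> free_Abelian_group (carrier U \<times> carrier V)"

definition tensor_kernel ::
  "('s, 'd) ring_scheme \<Rightarrow> ('r, 's, 'u, 'e) bimodule_scheme \<Rightarrow> ('s, 't, 'v, 'f) bimodule_scheme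
    \<Rightarrow> ('u \<times> 'v \<Rightarrow>\<^sub>0 int) set" where
  "tensor_kernel S U V = generate (tensor_free U V) (tensor_relations S U V)"

definition tensor ::
  "('s, 'd) ring_scheme \<Rightarrow> ('r, 's, 'u, 'e) bimodule_scheme \<Rightarrow> ('s, 't, 'v, 'f) bimodule_scheme
    \<Rightarrow> ('r, 't, ('u \<times> 'v \<Rightarrow>\<^sub>0 int) set) bimodule" where
  "tensor S U V =
    (let F = tensor_free U V; N = tensor_kernel S U V; Q = F Mod N in
     \<lparr>carrier = carrier Q, monoid.mult = undefined, one = undefined, ring.zero = \<one>\<^bsub>Q\<^esub>, ring.add = monoid.mult Q,
      lact = (\<lambda>r C. N <#>\<^bsub>F\<^esub> frag_extend (\<lambda>(u, v). frag_of (lact U r u, v)) ` C),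
      ract = (\<lambda>C t. N <#>\<^bsub>F\<^esub> frag_extend (\<lambda>(u, v). frag_of (u, ract V v t)) ` C)\<rparr>)"

definition pure_tensor ::
  "('s, 'd) ring_scheme \<Rightarrow> ('r, 's, 'u, 'e) bimodule_scheme \<Rightarrow> ('s, 't, 'v, 'f) bimodule_scheme
    \<Rightarrow> 'u \<Rightarrow> 'v \<Rightarrow> ('u \<times> 'v \<Rightarrow>\<^sub>0 int) set" where
  "pure_tensor S U V u v = tensor_kernel S U V #>\<^bsub>tensor_free U V\<^esub> frag_of (u, v)"

definition morita_context ::
  "('r, 'c) ring_scheme \<Rightarrow> ('s, 'd) ring_scheme \<Rightarrow> ('r, 's, 'u, 'e) bimodule_scheme
    \<Rightarrow> ('s, 'r, 'v, 'f) bimodule_scheme \<Rightarrow> (('u \<times> 'v \<Rightarrow>\<^sub>0 int) set \<Rightarrow> 'r)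
    \<Rightarrow> (('v \<times> 'u \<Rightarrow>\<^sub>0 int) set \<Rightarrow> 's) \<Rightarrow> bool" where
  "morita_context R S U V \<mu> \<nu> \<longleftrightarrow> ring R \<and> ring S \<and> bimodule R S U \<and> bimodule S R V
     \<and> bimodule_hom R R (tensor S U V) (sub_bimodule R (carrier R)) \<mu>
     \<and> bimodule_hom S S (tensor R V U) (sub_bimodule S (carrier S)) \<nu>
     \<and> (\<forall>u\<in>carrier U. \<forall>u'\<in>carrier U. \<forall>v\<in>carrier V.
          ract U u (\<nu> (pure_tensor R V U v u')) = lact U (\<mu> (pure_tensor S U V u v)) u')
     \<and> (\<forall>v\<in>carrier V. \<forall>v'\<in>carrier V. \<forall>u\<in>carrier U.
          ract V v (\<mu> (pure_tensor S U V u v')) = lact V (\<nu> (pure_tensor R V U v u)) v')"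

end

theory Submission
  imports Defs "HOL-Algebra.Ideal"
begin

text \<open>Multiplication by \<open>1\<^sub>g'\<close>, \<open>g'\<close> the inverse of \<open>g\<close>, turns every \<open>\<beta>\<^sub>g\<close> into an additive
  and multiplicative map \<open>b\<^sub>g\<close> that is defined on all of \<open>A\<close> and satisfies
  \<open>b\<^sub>g (b\<^sub>h a) = 1\<^sub>g b\<^sub>g\<^sub>h a\<close>; from this identity the skew groupoid ring \<open>R\<close> is associative and unital.
  The idempotent \<open>e = 1\<^sub>x \<delta>\<^sub>x\<close> cuts out \<open>S = e R e\<close>, so \<open>R e\<close> and \<open>e R\<close> form the standard Morita
  context of an idempotent, and \<open>\<nu>\<close> is surjective. Its \<open>\<mu>\<close> is surjective iff \<open>R e R = R\<close>. By globality, with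
  \<open>g = \<tau>\<^sub>y\<close>, \<open>1\<^sub>y \<delta>\<^sub>y = (1\<^sub>g \<delta>\<^sub>g) e (1\<^sub>g' \<delta>\<^sub>g')\<close> lies in \<open>R e R\<close> for every object \<open>y\<close>, and these
  elements sum to the identity.\<close>

section \<open>Tensor products of bimodules\<close>

text \<open>The maps \<open>\<beta> g\<close> are partial, so every product in the skew ring carries
  a domain condition, and for ideals without identity associativity can fail. Total maps trade these
  conditions for central idempotents: the law for \<open>b g (b h a)\<close> encodes the classical
  equality between the image under \<open>g\<close> of the intersection of the ideals at g' and h,
  and the intersection of the ideals at g and gh. It is not proved for \<open>\<beta>\<close>
  directly. On the isotropy group \<open>\<gamma>\<close> is a partial action by hypothesis, the law
  is proved there, and the functor sending g to its loop carries it to the whole groupoid. The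
  transport needs maps between \<open>I x\<close> and \<open>I y\<close> that lose nothing.
  Globality supplies them: \<open>\<gamma> (\<tau> y)\<close> is an isomorphism of all of
  \<open>I x\<close> onto all of \<open>I y\<close>, and the identity of \<open>I y\<close> projects
  the whole ring onto \<open>I y\<close>. The tensor products are quotients of free abelian groups,
  so the two pairings cannot simply be written down on elements; both come from a universal property
  that is proved for arbitrary bimodules.\<close>

declare carrier_free_Abelian_group_iff [simp del]

locale tensor_product = U: bimodule R S U + V: bimodule S T V
  for R :: "('r, 'c) ring_scheme" and S :: "('s, 'd) ring_scheme" and T :: "('t, 'g) ring_scheme"
    and U :: "('r, 's, 'u, 'e) bimodule_scheme" and V :: "('s, 't, 'v, 'f) bimodule_scheme"
begin

abbreviation F where "F \<equiv> tensor_free U V"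

abbreviation N where "N \<equiv> tensor_kernel S U V"

definition cls where "cls a = N #>\<^bsub>F\<^esub> a"

text \<open>The actions on formal sums, given on generators and extended additively. They induce
  \<open>lact\<close> and \<open>ract\<close> of \<open>tensor\<close> on cosets.\<close>

definition lfree where "lfree r = frag_extend (\<lambda>(u, v). frag_of (lact U r u, v))"

definition rfree where "rfree t = frag_extend (\<lambda>(u, v). frag_of (u, ract V v t))"

sublocale F: comm_group F
  by (rule abelian_free_Abelian_group)

lemma F_diff: "\<lbrakk>a \<in> carrier F; b \<in> carrier F\<rbrakk> \<Longrightarrow> a - b \<in> carrier F"
  using keys_diff[of a b] by (auto simp: carrier_free_Abelian_group_iff)

lemma F_zero: "0 \<in> carrier F"
  using F.one_closed by simp

lemma F_inv: "a \<in> carrier F \<Longrightarrow> inv\<^bsub>F\<^esub> a = - a"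
  by (rule inv_free_Abelian_group) (simp add: carrier_free_Abelian_group_iff)

lemma F_add: "\<lbrakk>a \<in> carrier F; b \<in> carrier F\<rbrakk> \<Longrightarrow> a + b \<in> carrier F"
  using F.m_closed by simp

lemma frag_of_F: "\<lbrakk>u \<in> carrier U; v \<in> carrier V\<rbrakk> \<Longrightarrow> frag_of (u, v) \<in> carrier F"
  by simp

lemma relations_subset: "tensor_relations S U V \<subseteq> carrier F"
proof
  fix c assume "c \<in> tensor_relations S U V"
  then show "c \<in> carrier F"
    unfolding tensor_relations_def Un_iff mem_Collect_eq
    by (elim disjE exE conjE; simp only:)
      (intro F_diff frag_of_F U.M.a_closed V.M.a_closed U.ract_closed V.lact_closed; assumption)+
qed

lemma N_subgroup: "subgroup N F"
  unfolding tensor_kernel_def by (rule F.generate_is_subgroup[OF relations_subset])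

sublocale N: normal N F
  using F.normal_iff_subgroup N_subgroup by blast

lemma N_F: "a \<in> N \<Longrightarrow> a \<in> carrier F"
  by (rule N.mem_carrier)

lemma N_zero: "0 \<in> N"
  using N.one_closed by simp

lemma N_add: "\<lbrakk>a \<in> N; b \<in> N\<rbrakk> \<Longrightarrow> a + b \<in> N"
  using N.m_closed by simp

lemma N_uminus: "a \<in> N \<Longrightarrow> - a \<in> N"
  using N.m_inv_closed[of a] F_inv[OF N_F[of a]] by simp

lemma N_diff: "\<lbrakk>a \<in> N; b \<in> N\<rbrakk> \<Longrightarrow> a - b \<in> N"
  using N_add[OF _ N_uminus] by simp

lemma relation_N: "c \<in> tensor_relations S U V \<Longrightarrow> c \<in> N"
  unfolding tensor_kernel_def by (rule generate.incl)

lemma N_add_l: "\<lbrakk>u \<in> carrier U; u' \<in> carrier U; v \<in> carrier V\<rbrakk> \<Longrightarrow>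
    frag_of (u \<oplus>\<^bsub>U\<^esub> u', v) - frag_of (u, v) - frag_of (u', v) \<in> N"
  by (rule relation_N) (auto simp: tensor_relations_def)

lemma N_add_r: "\<lbrakk>u \<in> carrier U; v \<in> carrier V; v' \<in> carrier V\<rbrakk> \<Longrightarrow>
    frag_of (u, v \<oplus>\<^bsub>V\<^esub> v') - frag_of (u, v) - frag_of (u, v') \<in> N"
  by (rule relation_N) (auto simp: tensor_relations_def)

lemma N_balance: "\<lbrakk>u \<in> carrier U; s \<in> carrier S; v \<in> carrier V\<rbrakk> \<Longrightarrow>
    frag_of (ract U u s, v) - frag_of (u, lact V s v) \<in> N"
  by (rule relation_N) (auto simp: tensor_relations_def)

lemma cls_eq: "cls a = (\<lambda>n. n + a) ` N"
  by (auto simp: cls_def r_coset_def)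

text \<open>A coset is a translate of \<open>N\<close> in the group of all finitely supported
  functions, so the usual criterion also covers representatives outside
  \<open>carrier F\<close>.\<close>

lemma cls_eq_iff: "cls a = cls b \<longleftrightarrow> a - b \<in> N"
proof
  assume "cls a = cls b"
  then have "a \<in> cls b"
    using N_zero unfolding cls_eq by (metis add_0 imageI)
  then show "a - b \<in> N" by (auto simp: cls_eq)
next
  assume ab: "a - b \<in> N"
  have "n + a \<in> cls b" if "n \<in> N" for n
    unfolding cls_eq using N_add[OF that ab] by (intro image_eqI[of _ _ "n + (a - b)"]) auto
  moreover have "n + b \<in> cls a" if "n \<in> N" for n
    unfolding cls_eq using N_diff[OF that ab] by (intro image_eqI[of _ _ "n - (a - b)"]) auto
  ultimately show "cls a = cls b" by (auto simp: cls_eq)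
qed

lemma tensor_simps:
  "carrier (tensor S U V) = cls ` carrier F"
  "\<zero>\<^bsub>tensor S U V\<^esub> = cls 0"
proof -
  show "carrier (tensor S U V) = cls ` carrier F"
    by (simp add: tensor_def Let_def carrier_FactGroup cls_def[abs_def])
  show "\<zero>\<^bsub>tensor S U V\<^esub> = cls 0"
    using F.coset_mult_one[OF N.subset]
    by (simp add: tensor_def Let_def FactGroup_def cls_def)
qed

lemma tensor_add: "\<lbrakk>a \<in> carrier F; b \<in> carrier F\<rbrakk> \<Longrightarrow> cls a \<oplus>\<^bsub>tensor S U V\<^esub> cls b = cls (a + b)"
  using N.rcos_sum[of a b] by (simp add: tensor_def Let_def FactGroup_def cls_def)

lemma pure_tensor_eq: "pure_tensor S U V u v = cls (frag_of (u, v))"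
  by (simp add: pure_tensor_def cls_def)

lemma F_induct [consumes 1, case_names zero diff frag_of]:
  assumes "a \<in> carrier F" and "Q 0"
    and "\<And>a b. \<lbrakk>a \<in> carrier F; b \<in> carrier F; Q a; Q b\<rbrakk> \<Longrightarrow> Q (a - b)"
    and "\<And>u v. \<lbrakk>u \<in> carrier U; v \<in> carrier V\<rbrakk> \<Longrightarrow> Q (frag_of (u, v))"
  shows "Q a"
  by (rule free_Abelian_group_induct[of a "carrier U \<times> carrier V" Q])
    (use assms in \<open>auto simp: carrier_free_Abelian_group_iff\<close>)

text \<open>Both sides of a bimodule law are additive in the formal sum, so modulo \<open>N\<close>
  the law has to be checked on generators only. Additivity is stated for differences to match
  \<open>F_induct\<close>.\<close>

lemma cong_additive:
  assumes a: "a \<in> carrier F"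
    and f: "\<And>a b. f (a - b) = f a - f b" and g: "\<And>a b. g (a - b) = g a - g b"
    and gen: "\<And>u v. \<lbrakk>u \<in> carrier U; v \<in> carrier V\<rbrakk> \<Longrightarrow> f (frag_of (u, v)) - g (frag_of (u, v)) \<in> N"
  shows "f a - g a \<in> N"
  using a
proof (induction a rule: F_induct)
  case zero
  have "f 0 = 0" "g 0 = 0" using f[of 0 0] g[of 0 0] by simp_all
  then show ?case using N_zero by simp
next
  case (diff a b)
  have "f (a - b) - g (a - b) = (f a - g a) - (f b - g b)" by (simp add: f g)
  then show ?case using N_diff[OF diff(3,4)] by simp
qed (rule gen)

lemma additive_F:
  assumes a: "a \<in> carrier F" and f: "\<And>a b. f (a - b) = f a - f b"
    and gen: "\<And>u v. \<lbrakk>u \<in> carrier U; v \<in> carrier V\<rbrakk> \<Longrightarrow> f (frag_of (u, v)) \<in> carrier F"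
  shows "f a \<in> carrier F"
  using a
proof (induction a rule: F_induct)
  case zero
  have "f 0 = 0" using f[of 0 0] by simp
  then show ?case by (simp add: F_zero)
next
  case (diff a b)
  then show ?case using F_diff[OF diff(3,4)] by (simp only: f)
qed (rule gen)

text \<open>The criterion for an operation on formal sums to descend to the quotient: it has to
  respect the generating relations.\<close>

lemma additive_N:
  assumes f: "\<And>a b. f (a - b) = f a - f b" and rel: "\<And>c. c \<in> tensor_relations S U V \<Longrightarrow> f c \<in> N"
    and n: "n \<in> N"
  shows "f n \<in> N"
  using n unfolding tensor_kernel_def[of S U V]
proof (induction n rule: generate.induct)
  case one
  have "f 0 = 0" using f[of 0 0] by simp
  then show ?case using N_zero by (simp add: tensor_kernel_def)
next
  case (incl h)
  then show ?case using rel by (simp add: tensor_kernel_def)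
next
  case (inv h)
  have "f 0 = 0" using f[of 0 0] by simp
  then have "f (- h) = - f h" using f[of 0 h] by simp
  moreover have "inv\<^bsub>F\<^esub> h = - h" by (rule F_inv[OF subsetD[OF relations_subset inv]])
  ultimately show ?case using N_uminus[OF rel[OF inv]] by (simp add: tensor_kernel_def)
next
  case (eng h1 h2)
  have "f 0 = 0" using f[of 0 0] by simp
  then have "f (- h2) = - f h2" using f[of 0 h2] by simp
  then have "f (h1 + h2) = f h1 + f h2" using f[of h1 "- h2"] by simp
  then show ?case using N_add eng(3,4) by (simp add: tensor_kernel_def)
qed

section \<open>The two actions on the tensor product\<close>

lemma lfree_diff: "lfree r (a - b) = lfree r a - lfree r b"
  and rfree_diff: "rfree t (a - b) = rfree t a - rfree t b"
  and lfree_add: "lfree r (a + b) = lfree r a + lfree r b"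
  and rfree_add: "rfree t (a + b) = rfree t a + rfree t b"
  and lfree_frag_of: "lfree r (frag_of (u, v)) = frag_of (lact U r u, v)"
  and rfree_frag_of: "rfree t (frag_of (u, v)) = frag_of (u, ract V v t)"
  by (simp_all add: lfree_def rfree_def frag_extend_diff frag_extend_add)

lemma lfree_F: "\<lbrakk>r \<in> carrier R; a \<in> carrier F\<rbrakk> \<Longrightarrow> lfree r a \<in> carrier F"
  by (rule additive_F) (auto simp: lfree_diff lfree_frag_of U.lact_closed)

lemma rfree_F: "\<lbrakk>t \<in> carrier T; a \<in> carrier F\<rbrakk> \<Longrightarrow> rfree t a \<in> carrier F"
  by (rule additive_F) (auto simp: rfree_diff rfree_frag_of V.ract_closed)

text \<open>Biadditivity relations go to relations of the same kind. The balance relation does too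
  because the actions of \<open>R\<close> and \<open>S\<close> on \<open>U\<close> commute.\<close>

lemma lfree_N:
  assumes "r \<in> carrier R" "n \<in> N" shows "lfree r n \<in> N"
proof (rule additive_N[OF lfree_diff _ assms(2)])
  fix c assume "c \<in> tensor_relations S U V"
  with assms(1) show "lfree r c \<in> N"
    by (auto simp: tensor_relations_def lfree_diff lfree_frag_of U.lact_add_r U.lact_ract[symmetric]
        U.lact_closed intro!: N_add_l N_add_r N_balance)
qed

lemma rfree_N:
  assumes "t \<in> carrier T" "n \<in> N" shows "rfree t n \<in> N"
proof (rule additive_N[OF rfree_diff _ assms(2)])
  fix c assume "c \<in> tensor_relations S U V"
  with assms(1) show "rfree t c \<in> N"
    by (auto simp: tensor_relations_def rfree_diff rfree_frag_of V.ract_add_l V.lact_ract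
        V.ract_closed intro!: N_add_l N_add_r N_balance)
qed

text \<open>The image of a coset under \<open>f\<close> is in general only part of a coset. Adding
  \<open>N\<close>, as the definition of \<open>tensor\<close> does, fills it up, and
  \<open>fN\<close> keeps the result inside a single coset.\<close>

lemma set_mult_cls:
  assumes f: "\<And>a b. f (a + b) = f a + f b" and fN: "\<And>n. n \<in> N \<Longrightarrow> f n \<in> N"
  shows "N <#>\<^bsub>F\<^esub> f ` cls a = cls (f a)"
proof
  show "N <#>\<^bsub>F\<^esub> f ` cls a \<subseteq> cls (f a)"
  proof
    fix c assume "c \<in> N <#>\<^bsub>F\<^esub> f ` cls a"
    then obtain m n where "m \<in> N" "n \<in> N" "c = m + f (n + a)"
      unfolding set_mult_def cls_eq by auto
    then have "c = (m + f n) + f a" "m + f n \<in> N" using N_add fN by (auto simp: f add.assoc)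
    then show "c \<in> cls (f a)" by (simp add: cls_eq)
  qed
  have "a \<in> cls a" unfolding cls_eq using N_zero by (metis add_0 imageI)
  then show "cls (f a) \<subseteq> N <#>\<^bsub>F\<^esub> f ` cls a"
    unfolding set_mult_def cls_eq[of "f a"] by auto
qed

lemma lact_cls: "r \<in> carrier R \<Longrightarrow> lact (tensor S U V) r (cls a) = cls (lfree r a)"
  using set_mult_cls[of "lfree r"] by (simp add: tensor_def Let_def lfree_add lfree_N flip: lfree_def)

lemma ract_cls: "t \<in> carrier T \<Longrightarrow> ract (tensor S U V) (cls a) t = cls (rfree t a)"
  using set_mult_cls[of "rfree t"] by (simp add: tensor_def Let_def rfree_add rfree_N flip: rfree_def)

lemma tensor_bimodule: "bimodule R T (tensor S U V)"
proof -
  interpret Q: abelian_group "tensor S U V"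
  proof (rule abelian_groupI, goal_cases)
    case (6 x)
    then obtain a where a: "a \<in> carrier F" "x = cls a" by (auto simp: tensor_simps(1))
    have "- a \<in> carrier F" using F_diff[OF F_zero a(1)] by simp
    with a show ?case by (intro bexI[of _ "cls (- a)"]) (auto simp: tensor_simps tensor_add)
  qed (auto simp: tensor_simps tensor_add F_add F_zero add_ac)
  show ?thesis
  \<comment> \<open>The cases are the axioms of \<open>bimodule\<close> in the order of their
    declaration. Cases 4 and 7, additivity in the tensor, hold already for formal sums; cases 3, 5,
    6 and 8 to 11 hold modulo \<open>N\<close> and are reduced to generators by
    \<open>cong_additive\<close>.\<close>
  proof (unfold_locales, goal_cases)
    case (1 r m)
    then show ?case by (auto simp: tensor_simps lact_cls intro: lfree_F)
  next
    case (2 m s)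
    then show ?case by (auto simp: tensor_simps ract_cls intro: rfree_F)
  next
    case (3 r r' m)
    then obtain a where a: "a \<in> carrier F" "m = cls a" by (auto simp: tensor_simps(1))
    have "lfree (r \<oplus>\<^bsub>R\<^esub> r') a - (lfree r a + lfree r' a) \<in> N"
    proof (rule cong_additive[OF a(1)])
      fix u v assume "u \<in> carrier U" "v \<in> carrier V"
      then show "lfree (r \<oplus>\<^bsub>R\<^esub> r') (frag_of (u, v)) - (lfree r (frag_of (u, v)) + lfree r' (frag_of (u, v))) \<in> N"
        using 3 N_add_l[of "lact U r u" "lact U r' u" v]
        by (simp add: lfree_frag_of U.lact_add_l U.lact_closed diff_diff_add)
    qed (simp_all add: lfree_diff)
    then show ?case
      using 3 a by (simp add: lact_cls tensor_add lfree_F cls_eq_iff)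
  next
    case (4 r m m')
    then obtain a a' where a: "a \<in> carrier F" "m = cls a" "a' \<in> carrier F" "m' = cls a'"
      by (auto simp: tensor_simps(1))
    then show ?case
      using 4 by (simp add: lact_cls tensor_add lfree_F lfree_add)
  next
    case (5 r r' m)
    then obtain a where a: "a \<in> carrier F" "m = cls a" by (auto simp: tensor_simps(1))
    have "lfree (r \<otimes>\<^bsub>R\<^esub> r') a - lfree r (lfree r' a) \<in> N"
      by (rule cong_additive[OF a(1)])
        (use 5 in \<open>auto simp: lfree_diff lfree_frag_of U.lact_mult N_zero\<close>)
    then show ?case using 5 a by (simp add: lact_cls cls_eq_iff)
  next
    case (6 m)
    then obtain a where a: "a \<in> carrier F" "m = cls a" by (auto simp: tensor_simps(1))
    have "lfree \<one>\<^bsub>R\<^esub> a - a \<in> N"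
      by (rule cong_additive[OF a(1)]) (auto simp: lfree_diff lfree_frag_of U.lact_one N_zero)
    then show ?case using a by (simp add: lact_cls cls_eq_iff)
  next
    case (7 m m' s)
    then obtain a a' where a: "a \<in> carrier F" "m = cls a" "a' \<in> carrier F" "m' = cls a'"
      by (auto simp: tensor_simps(1))
    then show ?case
      using 7 by (simp add: ract_cls tensor_add rfree_F rfree_add)
  next
    case (8 m s s')
    then obtain a where a: "a \<in> carrier F" "m = cls a" by (auto simp: tensor_simps(1))
    have "rfree (s \<oplus>\<^bsub>T\<^esub> s') a - (rfree s a + rfree s' a) \<in> N"
    proof (rule cong_additive[OF a(1)])
      fix u v assume "u \<in> carrier U" "v \<in> carrier V"
      then show "rfree (s \<oplus>\<^bsub>T\<^esub> s') (frag_of (u, v)) - (rfree s (frag_of (u, v)) + rfree s' (frag_of (u, v))) \<in> N"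
        using 8 N_add_r[of u "ract V v s" "ract V v s'"]
        by (simp add: rfree_frag_of V.ract_add_r V.ract_closed diff_diff_add)
    qed (simp_all add: rfree_diff)
    then show ?case
      using 8 a by (simp add: ract_cls tensor_add rfree_F cls_eq_iff)
  next
    case (9 m s s')
    then obtain a where a: "a \<in> carrier F" "m = cls a" by (auto simp: tensor_simps(1))
    have "rfree (s \<otimes>\<^bsub>T\<^esub> s') a - rfree s' (rfree s a) \<in> N"
      by (rule cong_additive[OF a(1)])
        (use 9 in \<open>auto simp: rfree_diff rfree_frag_of V.ract_mult N_zero\<close>)
    then show ?case using 9 a by (simp add: ract_cls cls_eq_iff)
  next
    case (10 m)
    then obtain a where a: "a \<in> carrier F" "m = cls a" by (auto simp: tensor_simps(1))
    have "rfree \<one>\<^bsub>T\<^esub> a - a \<in> N"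
      by (rule cong_additive[OF a(1)]) (auto simp: rfree_diff rfree_frag_of V.ract_one N_zero)
    then show ?case using a by (simp add: ract_cls cls_eq_iff)
  next
    case (11 r m s)
    then obtain a where a: "a \<in> carrier F" "m = cls a" by (auto simp: tensor_simps(1))
    have "rfree s (lfree r a) - lfree r (rfree s a) \<in> N"
      by (rule cong_additive[OF a(1)])
        (auto simp: rfree_diff lfree_diff lfree_frag_of rfree_frag_of N_zero)
    then show ?case using 11 a by (simp add: lact_cls ract_cls cls_eq_iff)
  qed
qed

lemma pure_tensor_closed:
  "\<lbrakk>u \<in> carrier U; v \<in> carrier V\<rbrakk> \<Longrightarrow> pure_tensor S U V u v \<in> carrier (tensor S U V)"
  by (simp add: tensor_simps pure_tensor_eq)

text \<open>The additive extension of \<open>\<phi>\<close> to formal sums kills the relations by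
  \<open>add_l\<close>, \<open>add_r\<close> and \<open>balanced\<close>, so it factors through the
  quotient. The hypotheses \<open>left\<close> and \<open>right\<close> make the factored map linear
  on both sides.\<close>

lemma tensor_universal:
  fixes P :: "('r, 't, 'p, 'h) bimodule_scheme"
  assumes P: "bimodule R T P"
    and closed: "\<And>u v. \<lbrakk>u \<in> carrier U; v \<in> carrier V\<rbrakk> \<Longrightarrow> \<phi> u v \<in> carrier P"
    and add_l: "\<And>u u' v. \<lbrakk>u \<in> carrier U; u' \<in> carrier U; v \<in> carrier V\<rbrakk>
      \<Longrightarrow> \<phi> (u \<oplus>\<^bsub>U\<^esub> u') v = \<phi> u v \<oplus>\<^bsub>P\<^esub> \<phi> u' v"
    and add_r: "\<And>u v v'. \<lbrakk>u \<in> carrier U; v \<in> carrier V; v' \<in> carrier V\<rbrakk>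
      \<Longrightarrow> \<phi> u (v \<oplus>\<^bsub>V\<^esub> v') = \<phi> u v \<oplus>\<^bsub>P\<^esub> \<phi> u v'"
    and balanced: "\<And>u s v. \<lbrakk>u \<in> carrier U; s \<in> carrier S; v \<in> carrier V\<rbrakk>
      \<Longrightarrow> \<phi> (ract U u s) v = \<phi> u (lact V s v)"
    and left: "\<And>r u v. \<lbrakk>r \<in> carrier R; u \<in> carrier U; v \<in> carrier V\<rbrakk>
      \<Longrightarrow> \<phi> (lact U r u) v = lact P r (\<phi> u v)"
    and right: "\<And>u v t. \<lbrakk>u \<in> carrier U; v \<in> carrier V; t \<in> carrier T\<rbrakk>
      \<Longrightarrow> \<phi> u (ract V v t) = ract P (\<phi> u v) t"
  obtains \<mu> where "bimodule_hom R T (tensor S U V) P \<mu>"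
    and "\<And>u v. \<lbrakk>u \<in> carrier U; v \<in> carrier V\<rbrakk> \<Longrightarrow> \<mu> (pure_tensor S U V u v) = \<phi> u v"
proof -
  interpret P: bimodule R T P by (rule P)
  have "(\<lambda>(u, v). \<phi> u v) ` (carrier U \<times> carrier V) \<subseteq> carrier (add_monoid P)"
    using closed by auto
  then obtain h where h: "h \<in> hom F (add_monoid P)"
    and h_frag: "\<And>p. p \<in> carrier U \<times> carrier V \<Longrightarrow> h (frag_of p) = (case p of (u, v) \<Rightarrow> \<phi> u v)"
    using comm_group.free_Abelian_group_universal[OF P.M.a_comm_group] by blast
  interpret h: group_hom F "add_monoid P" h
    using h by (simp add: group_hom_def group_hom_axioms_def P.M.a_group)
  have h_of: "h (frag_of (u, v)) = \<phi> u v" if "u \<in> carrier U" "v \<in> carrier V" for u v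
    using h_frag[of "(u, v)"] that by simp
  have h_closed: "h a \<in> carrier P" if "a \<in> carrier F" for a
    using h.hom_closed[OF that] by simp
  have h_add: "h (a + b) = h a \<oplus>\<^bsub>P\<^esub> h b" if "a \<in> carrier F" "b \<in> carrier F" for a b
    using h.hom_mult[OF that] by simp
  have h_uminus: "h (- b) = \<ominus>\<^bsub>P\<^esub> h b" if "b \<in> carrier F" for b
    using h.hom_inv[OF that] that
    by (simp add: a_inv_def F_inv)
  have h_diff: "h (a - b) = h a \<ominus>\<^bsub>P\<^esub> h b" if "a \<in> carrier F" "b \<in> carrier F" for a b
    using h_add[of a "- b"] h_uminus that F_diff[OF F_zero, of b] by (simp add: a_minus_def)
  have h_zero: "h 0 = \<zero>\<^bsub>P\<^esub>"
    using h.hom_one by simp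
  \<comment> \<open>The shape in which a biadditivity relation arrives in \<open>P\<close> once
    \<open>\<phi>\<close> has been expanded on the sum.\<close>
  have cancel: "p \<oplus>\<^bsub>P\<^esub> q \<ominus>\<^bsub>P\<^esub> p \<ominus>\<^bsub>P\<^esub> q = \<zero>\<^bsub>P\<^esub>" if "p \<in> carrier P" "q \<in> carrier P" for p q
    using that by (simp add: a_minus_def P.M.a_comm[of p q] P.M.a_assoc P.M.r_neg P.M.r_neg2)
  have "tensor_relations S U V \<subseteq> kernel F (add_monoid P) h"
  proof
    fix c assume c: "c \<in> tensor_relations S U V"
    then have cF: "c \<in> carrier F" using relations_subset by blast
    have "h (frag_of (u \<oplus>\<^bsub>U\<^esub> u', v) - frag_of (u, v) - frag_of (u', v)) = \<zero>\<^bsub>P\<^esub>"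
      if "u \<in> carrier U" "u' \<in> carrier U" "v \<in> carrier V" for u u' v
      using that by (simp add: h_diff F_diff h_of add_l closed cancel)
    moreover have "h (frag_of (u, v \<oplus>\<^bsub>V\<^esub> v') - frag_of (u, v) - frag_of (u, v')) = \<zero>\<^bsub>P\<^esub>"
      if "u \<in> carrier U" "v \<in> carrier V" "v' \<in> carrier V" for u v v'
      using that by (simp add: h_diff F_diff h_of add_r closed cancel)
    moreover have "h (frag_of (ract U u s, v) - frag_of (u, lact V s v)) = \<zero>\<^bsub>P\<^esub>"
      if "u \<in> carrier U" "s \<in> carrier S" "v \<in> carrier V" for u s v
      using that
      by (simp add: h_diff h_of balanced closed U.ract_closed V.lact_closed a_minus_def P.M.r_neg)
    ultimately have "h c = \<zero>\<^bsub>P\<^esub>"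
      using c unfolding tensor_relations_def by auto
    with cF show "c \<in> kernel F (add_monoid P) h" by (simp add: kernel_def)
  qed
  then have "N \<subseteq> kernel F (add_monoid P) h"
    unfolding tensor_kernel_def by (rule F.generate_subgroup_incl[OF _ h.subgroup_kernel])
  from h.FactGroup_universal_kernel[OF N.normal_axioms this]
  obtain \<mu> where \<mu>: "\<mu> \<in> hom (F Mod N) (add_monoid P)"
    and \<mu>_cls: "\<And>a. a \<in> carrier F \<Longrightarrow> \<mu> (cls a) = h a"
    unfolding cls_def by blast
  \<comment> \<open>As group homomorphisms the actions on \<open>P\<close> respect zero and
    negatives, which the inductions over formal sums below require.\<close>
  have lact_hom: "group_hom (add_monoid P) (add_monoid P) (lact P r)" if "r \<in> carrier R" for r
    using that by (auto simp: group_hom_def group_hom_axioms_def P.M.a_group hom_def P.lact_closed P.lact_add_r)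
  have ract_hom: "group_hom (add_monoid P) (add_monoid P) (\<lambda>m. ract P m t)" if "t \<in> carrier T" for t
    using that by (auto simp: group_hom_def group_hom_axioms_def P.M.a_group hom_def P.ract_closed P.ract_add_l)
  have lfree: "h (lfree r a) = lact P r (h a)" if r: "r \<in> carrier R" and a: "a \<in> carrier F" for r a
  proof (rule F_induct[OF a])
    interpret l: group_hom "add_monoid P" "add_monoid P" "lact P r" by (rule lact_hom[OF r])
    show "h (lfree r 0) = lact P r (h 0)"
      using l.hom_one by (simp add: lfree_def h_zero)
    show "h (lfree r (a - b)) = lact P r (h (a - b))" if "a \<in> carrier F" "b \<in> carrier F"
      "h (lfree r a) = lact P r (h a)" "h (lfree r b) = lact P r (h b)" for a b
      using that r l.hom_inv[of "h b"] h_closed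
      by (simp add: lfree_diff h_diff lfree_F a_minus_def P.lact_add_r a_inv_def)
  qed (use r in \<open>simp add: lfree_frag_of h_of U.lact_closed left\<close>)
  have rfree: "h (rfree t a) = ract P (h a) t" if t: "t \<in> carrier T" and a: "a \<in> carrier F" for t a
  proof (rule F_induct[OF a])
    interpret l: group_hom "add_monoid P" "add_monoid P" "\<lambda>m. ract P m t" by (rule ract_hom[OF t])
    show "h (rfree t 0) = ract P (h 0) t"
      using l.hom_one by (simp add: rfree_def h_zero)
    show "h (rfree t (a - b)) = ract P (h (a - b)) t" if "a \<in> carrier F" "b \<in> carrier F"
      "h (rfree t a) = ract P (h a) t" "h (rfree t b) = ract P (h b) t" for a b
      using that t l.hom_inv[of "h b"] h_closed
      by (simp add: rfree_diff h_diff rfree_F a_minus_def P.ract_add_l a_inv_def)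
  qed (use t in \<open>simp add: rfree_frag_of h_of V.ract_closed right\<close>)
  have "bimodule_hom R T (tensor S U V) P \<mu>"
    unfolding bimodule_hom_def tensor_simps
  proof (intro conjI ballI tensor_bimodule P)
    show "\<mu> \<in> cls ` carrier F \<rightarrow> carrier P"
      using h_closed \<mu>_cls by auto
  qed (auto simp: tensor_add lact_cls ract_cls \<mu>_cls h_add lfree_F rfree_F lfree rfree F_add
     )
  moreover have "\<mu> (pure_tensor S U V u v) = \<phi> u v" if "u \<in> carrier U" "v \<in> carrier V" for u v
    using that by (simp add: pure_tensor_eq \<mu>_cls h_of)
  ultimately show thesis by (rule that)
qed

end

section \<open>The Morita context of an idempotent\<close>

lemma sub_bimodule_simps [simp]:
  "\<zero>\<^bsub>sub_bimodule R X\<^esub> = \<zero>\<^bsub>R\<^esub>" "a \<oplus>\<^bsub>sub_bimodule R X\<^esub> b = a \<oplus>\<^bsub>R\<^esub> b"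
  "lact (sub_bimodule R X) = (\<otimes>\<^bsub>R\<^esub>)" "ract (sub_bimodule R X) = (\<otimes>\<^bsub>R\<^esub>)"
  by (simp_all add: sub_bimodule_def)

lemma (in ring) abelian_group_sub_bimodule:
  assumes X: "X \<subseteq> carrier R" and "\<zero> \<in> X" "\<And>a b. \<lbrakk>a \<in> X; b \<in> X\<rbrakk> \<Longrightarrow> a \<oplus> b \<in> X" "\<And>a. a \<in> X \<Longrightarrow> \<ominus> a \<in> X"
  shows "abelian_group (sub_bimodule R X)"
proof (rule abelian_groupI)
  have carr: "carrier (sub_bimodule R X) = X" by (simp add: sub_bimodule_def)
  show "\<exists>y\<in>carrier (sub_bimodule R X). y \<oplus>\<^bsub>sub_bimodule R X\<^esub> x = \<zero>\<^bsub>sub_bimodule R X\<^esub>"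
    if "x \<in> carrier (sub_bimodule R X)" for x
    using that assms by (intro bexI[of _ "\<ominus> x"]) (auto simp: carr l_neg)
qed (use assms in \<open>auto simp: sub_bimodule_def subset_iff intro: a_assoc a_comm\<close>)

lemma (in ring) bimodule_carrier: "bimodule R R (sub_bimodule R (carrier R))"
proof -
  interpret M: abelian_group "sub_bimodule R (carrier R)"
    by (rule abelian_group_sub_bimodule) auto
  show ?thesis
    by unfold_locales (auto simp: sub_bimodule_def m_assoc l_distr r_distr)
qed

text \<open>\<open>S\<close> is a separate record whose operations agree with those of
  \<open>R\<close> on \<open>carrier S\<close> only. This fits the skew ring of the isotropy group,
  whose product sums over fewer pairs of morphisms.\<close>

locale corner_ring = R?: ring R
  for R :: "('r, 'c) ring_scheme" (structure) and e :: 'r and S :: "('r, 'd) ring_scheme" +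
  assumes e_closed [simp]: "e \<in> carrier R" and e_idem [simp]: "e \<otimes> e = e"
    and carrier_S: "carrier S = {e \<otimes> r \<otimes> e | r. r \<in> carrier R}"
    and mult_S: "\<lbrakk>a \<in> carrier S; b \<in> carrier S\<rbrakk> \<Longrightarrow> a \<otimes>\<^bsub>S\<^esub> b = a \<otimes> b"
    and add_S: "\<lbrakk>a \<in> carrier S; b \<in> carrier S\<rbrakk> \<Longrightarrow> a \<oplus>\<^bsub>S\<^esub> b = a \<oplus> b"
    and zero_S: "\<zero>\<^bsub>S\<^esub> = \<zero>" and one_S: "\<one>\<^bsub>S\<^esub> = e"
begin

abbreviation "U \<equiv> sub_bimodule R {r \<otimes> e | r. r \<in> carrier R}"

abbreviation "V \<equiv> sub_bimodule R {e \<otimes> r | r. r \<in> carrier R}"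

text \<open>Idempotence turns each one-sided or two-sided multiple of \<open>e\<close> into a fixed
  point, and a fixed point is its own witness. In this form the bimodule axioms reduce to
  associativity and distributivity in \<open>R\<close>.\<close>

lemma U_iff: "u \<in> carrier U \<longleftrightarrow> u \<in> carrier R \<and> u \<otimes> e = u"
  by (auto simp: sub_bimodule_def m_assoc) metis

lemma V_iff: "v \<in> carrier V \<longleftrightarrow> v \<in> carrier R \<and> e \<otimes> v = v"
  by (auto simp: sub_bimodule_def simp flip: m_assoc) metis

lemma S_iff: "s \<in> carrier S \<longleftrightarrow> s \<in> carrier R \<and> e \<otimes> s = s \<and> s \<otimes> e = s"
proof -
  have "e \<otimes> (e \<otimes> r \<otimes> e) = e \<otimes> r \<otimes> e" if "r \<in> carrier R" for r
    using that by (simp flip: m_assoc)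
  moreover have "e \<otimes> r \<otimes> e \<otimes> e = e \<otimes> r \<otimes> e" if "r \<in> carrier R" for r
    using that by (simp add: m_assoc)
  ultimately show ?thesis unfolding carrier_S by auto metis
qed

lemma ring_S: "ring S"
proof (intro ringI abelian_groupI monoidI)
  fix a assume a: "a \<in> carrier S"
  have "\<ominus> a \<in> carrier S" "\<ominus> a \<oplus> a = \<zero>" using a by (simp_all add: S_iff r_minus l_minus l_neg)
  then show "\<exists>b\<in>carrier S. b \<oplus>\<^bsub>S\<^esub> a = \<zero>\<^bsub>S\<^esub>"
    using a by (intro bexI[of _ "\<ominus> a"]) (simp_all add: add_S zero_S)
next
  have closed: "a \<otimes> b \<in> carrier S" "a \<oplus> b \<in> carrier S" if "a \<in> carrier S" "b \<in> carrier S" for a b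
    using that by (auto simp: S_iff m_assoc l_distr r_distr simp flip: m_assoc[of e])
  show "a \<otimes>\<^bsub>S\<^esub> b \<in> carrier S" "a \<oplus>\<^bsub>S\<^esub> b \<in> carrier S" if "a \<in> carrier S" "b \<in> carrier S" for a b
    using that by (simp_all add: mult_S add_S closed)
  show "a \<otimes>\<^bsub>S\<^esub> b \<otimes>\<^bsub>S\<^esub> c = a \<otimes>\<^bsub>S\<^esub> (b \<otimes>\<^bsub>S\<^esub> c)" "a \<oplus>\<^bsub>S\<^esub> b \<oplus>\<^bsub>S\<^esub> c = a \<oplus>\<^bsub>S\<^esub> (b \<oplus>\<^bsub>S\<^esub> c)"
    "(a \<oplus>\<^bsub>S\<^esub> b) \<otimes>\<^bsub>S\<^esub> c = a \<otimes>\<^bsub>S\<^esub> c \<oplus>\<^bsub>S\<^esub> b \<otimes>\<^bsub>S\<^esub> c" "c \<otimes>\<^bsub>S\<^esub> (a \<oplus>\<^bsub>S\<^esub> b) = c \<otimes>\<^bsub>S\<^esub> a \<oplus>\<^bsub>S\<^esub> c \<otimes>\<^bsub>S\<^esub> b"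
    if "a \<in> carrier S" "b \<in> carrier S" "c \<in> carrier S" for a b c
    using that closed by (simp_all add: mult_S add_S) (simp_all add: S_iff m_assoc a_assoc l_distr r_distr)
  show "a \<oplus>\<^bsub>S\<^esub> b = b \<oplus>\<^bsub>S\<^esub> a" if "a \<in> carrier S" "b \<in> carrier S" for a b
    using that by (simp add: add_S S_iff a_comm)
  have one: "e \<in> carrier S" and zero: "\<zero> \<in> carrier S" by (simp_all add: S_iff)
  show "\<zero>\<^bsub>S\<^esub> \<in> carrier S" "\<one>\<^bsub>S\<^esub> \<in> carrier S" by (simp_all add: zero_S one_S one zero)
  show "\<zero>\<^bsub>S\<^esub> \<oplus>\<^bsub>S\<^esub> a = a" "\<one>\<^bsub>S\<^esub> \<otimes>\<^bsub>S\<^esub> a = a" "a \<otimes>\<^bsub>S\<^esub> \<one>\<^bsub>S\<^esub> = a" if "a \<in> carrier S" for a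
    using that one zero by (simp_all add: mult_S add_S zero_S one_S) (simp_all add: S_iff)
qed

sublocale S: ring S by (rule ring_S)

lemma bimodule_U: "bimodule R S U"
proof -
  interpret U: abelian_group U
    by (rule abelian_group_sub_bimodule)
      (use U_iff in \<open>auto simp: sub_bimodule_def l_distr l_minus\<close>)
  show ?thesis
    by unfold_locales (auto simp: U_iff S_iff one_S mult_S add_S m_assoc l_distr r_distr)
qed

lemma bimodule_V: "bimodule S R V"
proof -
  interpret V: abelian_group V
    by (rule abelian_group_sub_bimodule)
      (use V_iff in \<open>auto simp: sub_bimodule_def r_distr r_minus\<close>)
  show ?thesis
    by unfold_locales (auto simp: V_iff S_iff one_S mult_S add_S m_assoc l_distr r_distr simp flip: m_assoc[of e])
qed

lemma mult_VU: "\<lbrakk>v \<in> carrier V; u \<in> carrier U\<rbrakk> \<Longrightarrow> v \<otimes> u \<in> carrier S"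
  by (auto simp: U_iff V_iff S_iff m_assoc simp flip: m_assoc[of e])

text \<open>The image of \<open>\<mu>\<close> is a two-sided ideal because \<open>\<mu>\<close> is
  linear on both sides, and it contains \<open>e\<close>, the value at the pure tensor of
  \<open>e\<close> with \<open>e\<close>. For \<open>\<nu>\<close>, an element \<open>s\<close> of
  \<open>S\<close> lies in \<open>V\<close> and is the value at the pure tensor of \<open>s\<close>
  with \<open>e\<close>.\<close>

theorem morita_context:
  assumes full: "Idl {e} = carrier R"
  shows "\<exists>\<mu> \<nu>.
      (\<forall>u\<in>carrier U. \<forall>v\<in>carrier V. \<mu> (pure_tensor S U V u v) = u \<otimes> v)
    \<and> (\<forall>v\<in>carrier V. \<forall>u\<in>carrier U. \<nu> (pure_tensor R V U v u) = v \<otimes> u)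
    \<and> morita_context R S U V \<mu> \<nu>
    \<and> \<mu> ` carrier (tensor S U V) = carrier R
    \<and> \<nu> ` carrier (tensor R V U) = carrier S"
proof -
  interpret U: bimodule R S U by (rule bimodule_U)
  interpret V: bimodule S R V by (rule bimodule_V)
  interpret UV: tensor_product R S R U V ..
  interpret VU: tensor_product S R S V U ..
  obtain \<mu> where \<mu>: "bimodule_hom R R (tensor S U V) (sub_bimodule R (carrier R)) \<mu>"
    and \<mu>_pure: "\<And>u v. \<lbrakk>u \<in> carrier U; v \<in> carrier V\<rbrakk> \<Longrightarrow> \<mu> (pure_tensor S U V u v) = u \<otimes> v"
  proof (rule UV.tensor_universal[OF bimodule_carrier, of "(\<otimes>)"])
    show "u \<otimes> v \<in> carrier (sub_bimodule R (carrier R))" if "u \<in> carrier U" "v \<in> carrier V" for u v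
      using that by (simp add: U_iff V_iff) (simp add: sub_bimodule_def)
  qed (auto simp: U_iff V_iff S_iff l_distr r_distr m_assoc)
  obtain \<nu> where \<nu>: "bimodule_hom S S (tensor R V U) (sub_bimodule S (carrier S)) \<nu>"
    and \<nu>_pure: "\<And>v u. \<lbrakk>v \<in> carrier V; u \<in> carrier U\<rbrakk> \<Longrightarrow> \<nu> (pure_tensor R V U v u) = v \<otimes> u"
  proof (rule VU.tensor_universal[OF S.bimodule_carrier, of "(\<otimes>)"])
    show "v \<otimes> u \<in> carrier (sub_bimodule S (carrier S))" if "v \<in> carrier V" "u \<in> carrier U" for v u
      using mult_VU[OF that] by (simp add: sub_bimodule_def)
  qed (auto simp: mult_VU add_S mult_S, auto simp: U_iff V_iff S_iff l_distr r_distr m_assoc)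
  interpret TU: bimodule R R "tensor S U V" by (rule UV.tensor_bimodule)
  let ?J = "\<mu> ` carrier (tensor S U V)"
  have \<mu>_add: "\<mu> (m \<oplus>\<^bsub>tensor S U V\<^esub> m') = \<mu> m \<oplus> \<mu> m'"
    if "m \<in> carrier (tensor S U V)" "m' \<in> carrier (tensor S U V)" for m m'
    using \<mu> that by (simp add: bimodule_hom_def)
  have \<mu>_closed: "\<mu> m \<in> carrier R" if "m \<in> carrier (tensor S U V)" for m
    using \<mu> that by (auto simp: bimodule_hom_def sub_bimodule_def)
  have \<mu>_l: "\<mu> (lact (tensor S U V) r m) = r \<otimes> \<mu> m" and \<mu>_r: "\<mu> (ract (tensor S U V) m r) = \<mu> m \<otimes> r"
    if "r \<in> carrier R" "m \<in> carrier (tensor S U V)" for r m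
    using \<mu> that by (auto simp: bimodule_hom_def)
  have "ideal ?J R"
  proof (rule idealI)
    show "ring R" by (rule R.ring_axioms)
    interpret group_hom "add_monoid (tensor S U V)" "add_monoid R" \<mu>
      using \<mu>_add \<mu>_closed
      by (auto simp: group_hom_def group_hom_axioms_def hom_def TU.M.a_group a_group)
    show "subgroup ?J (add_monoid R)" using img_is_subgroup by simp
  next
    fix a r assume "a \<in> ?J" "r \<in> carrier R"
    then show "r \<otimes> a \<in> ?J" "a \<otimes> r \<in> ?J"
      by (auto simp flip: \<mu>_l \<mu>_r intro!: imageI TU.lact_closed TU.ract_closed)
  qed
  moreover have "e \<in> ?J"
  proof -
    have e: "e \<in> carrier U" "e \<in> carrier V" unfolding U_iff V_iff by simp_all
    show ?thesis by (rule image_eqI[OF _ UV.pure_tensor_closed[OF e]]) (simp only: \<mu>_pure[OF e] e_idem)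
  qed
  ultimately have "carrier R \<subseteq> ?J" using genideal_minimal[of ?J "{e}"] full by simp
  then have \<mu>_surj: "?J = carrier R" using \<mu>_closed by blast
  have \<nu>_surj: "\<nu> ` carrier (tensor R V U) = carrier S"
  proof
    show "\<nu> ` carrier (tensor R V U) \<subseteq> carrier S"
      using \<nu> by (auto simp: bimodule_hom_def sub_bimodule_def)
    show "carrier S \<subseteq> \<nu> ` carrier (tensor R V U)"
    proof
      fix s assume "s \<in> carrier S"
      then have s: "s \<in> carrier V" and e: "e \<in> carrier U" and se: "s \<otimes> e = s"
        unfolding U_iff V_iff S_iff by auto
      show "s \<in> \<nu> ` carrier (tensor R V U)"
        by (rule image_eqI[OF _ VU.pure_tensor_closed[OF s e]]) (simp only: \<nu>_pure[OF s e] se)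
    qed
  qed
  have "morita_context R S U V \<mu> \<nu>"
    unfolding morita_context_def
    using R.ring_axioms ring_S bimodule_U bimodule_V \<mu> \<nu>
    by (auto simp: \<mu>_pure \<nu>_pure U_iff V_iff m_assoc)
  with \<mu>_pure \<nu>_pure \<mu>_surj \<nu>_surj show ?thesis by blast
qed

end

section \<open>Groupoids\<close>

context groupoid
begin

lemma is_inverse_ginv:
  assumes g: "g \<in> Mor G" shows "is_inverse G g (ginv G g)"
proof -
  obtain h where h: "is_inverse G g h" using invertible[OF g] by blast
  have "h' = h" if h': "is_inverse G g h'" for h'
  proof -
    have "cmp G (cmp G h' g) h = cmp G h' (cmp G g h)"
      using g h h' by (intro cmp_assoc) (auto simp: is_inverse_def)
    then show ?thesis
      using h h' cmp_tgt[of h] cmp_src[of h'] by (simp add: is_inverse_def)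
  qed
  then show ?thesis unfolding ginv_def using h by (metis theI)
qed

lemma ginv_simps [simp]:
  assumes "g \<in> Mor G"
  shows "ginv G g \<in> Mor G" "src G (ginv G g) = tgt G g" "tgt G (ginv G g) = src G g"
    "cmp G (ginv G g) g = src G g" "cmp G g (ginv G g) = tgt G g"
  using is_inverse_ginv[OF assms] by (auto simp: is_inverse_def)

text \<open>A one-sided inverse suffices: multiply \<open>cmp G h g\<close> on the right by
  \<open>ginv G g\<close>.\<close>

lemma ginv_unique:
  assumes "g \<in> Mor G" "h \<in> Mor G" "src G h = tgt G g" "tgt G h = src G g" "cmp G h g = src G g"
  shows "ginv G g = h"
proof -
  have "cmp G (cmp G h g) (ginv G g) = cmp G h (cmp G g (ginv G g))"
    using assms by (intro cmp_assoc) auto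
  then show ?thesis using assms cmp_src[of h] cmp_tgt[of "ginv G g"] by simp
qed

lemma ginv_ginv [simp]: "g \<in> Mor G \<Longrightarrow> ginv G (ginv G g) = g"
  by (rule ginv_unique) auto

lemma cmp_ginv_cancel:
  assumes "g \<in> Mor G" "k \<in> Mor G" "tgt G g = tgt G k"
  shows "cmp G g (cmp G (ginv G g) k) = k"
  using assms cmp_assoc[of g "ginv G g" k] cmp_tgt[of k] by simp

lemma ginv_cmp_cancel:
  assumes "g \<in> Mor G" "h \<in> Mor G" "src G g = tgt G h"
  shows "cmp G (ginv G g) (cmp G g h) = h"
  using assms cmp_assoc[of "ginv G g" g h] cmp_tgt[of h] by simp

lemma ginv_cmp:
  assumes "g \<in> Mor G" "h \<in> Mor G" "src G g = tgt G h"
  shows "ginv G (cmp G g h) = cmp G (ginv G h) (ginv G g)"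
proof (rule ginv_unique)
  have "cmp G (cmp G (ginv G h) (ginv G g)) (cmp G g h) = cmp G (ginv G h) (cmp G (ginv G g) (cmp G g h))"
    using assms by (intro cmp_assoc) (auto simp: cmp_closed src_cmp tgt_cmp)
  then show "cmp G (cmp G (ginv G h) (ginv G g)) (cmp G g h) = src G (cmp G g h)"
    using assms by (simp add: ginv_cmp_cancel src_cmp)
qed (use assms in \<open>auto simp: cmp_closed src_cmp tgt_cmp\<close>)

lemma Obj_simps:
  assumes "y \<in> Obj G"
  shows "y \<in> Mor G" "src G y = y" "tgt G y = y" "ginv G y = y"
proof -
  show *: "y \<in> Mor G" "src G y = y" "tgt G y = y"
    using assms by (auto simp: Obj_def src_closed src_src tgt_src)
  show "ginv G y = y"
    using * cmp_src[of y] by (intro ginv_unique) auto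
qed

lemma src_Obj [simp]: "g \<in> Mor G \<Longrightarrow> src G g \<in> Obj G"
  and tgt_Obj [simp]: "g \<in> Mor G \<Longrightarrow> tgt G g \<in> Obj G"
proof -
  show "g \<in> Mor G \<Longrightarrow> tgt G g \<in> Obj G"
    unfolding Obj_def using src_tgt[of g] tgt_closed[of g] by (metis imageI)
qed (simp add: Obj_def)

text \<open>The change of summation variable in the proof that the skew product is
  associative.\<close>

lemma bij_betw_left_translation:
  assumes g: "g \<in> Mor G"
  shows "bij_betw (cmp G (ginv G g)) {p \<in> Mor G. tgt G p = tgt G g} {h \<in> Mor G. tgt G h = src G g}"
  by (rule bij_betw_byWitness[where f' = "cmp G g"])
    (use g in \<open>auto simp: cmp_ginv_cancel ginv_cmp_cancel cmp_closed tgt_cmp\<close>)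

end

section \<open>Partial skew groupoid rings\<close>

lemma rng_oneI: "is_rng_one J u \<Longrightarrow> rng_one J = u"
  unfolding rng_one_def by (rule the_equality) (assumption, metis is_rng_one_def)

text \<open>A partial action with unital ideals, given by the maps \<open>b g : a \<mapsto> \<alpha>\<^sub>g (a 1)\<close> that are
  defined on the whole ring, where \<open>1\<close> is the identity of the domain of \<open>\<alpha>\<^sub>g\<close>.\<close>

locale total_partial_action = groupoid G
  for G :: "('g, 'z) category_scheme" +
  fixes \<epsilon> :: "'g \<Rightarrow> 'a::ring" and b :: "'g \<Rightarrow> 'a \<Rightarrow> 'a"
    and D :: "'g \<Rightarrow> 'a set" and \<alpha> :: "'g \<Rightarrow> 'a \<rightharpoonup> 'a"
  assumes finite_Mor: "finite (Mor G)"
    and central: "g \<in> Mor G \<Longrightarrow> \<epsilon> g * a = a * \<epsilon> g"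
    and idem: "g \<in> Mor G \<Longrightarrow> \<epsilon> g * \<epsilon> g = \<epsilon> g"
    and b_add: "g \<in> Mor G \<Longrightarrow> b g (a + a') = b g a + b g a'"
    and b_mult: "g \<in> Mor G \<Longrightarrow> b g (a * a') = b g a * b g a'"
    and eps_b: "g \<in> Mor G \<Longrightarrow> \<epsilon> g * b g a = b g a"
    and eps_tgt: "g \<in> Mor G \<Longrightarrow> \<epsilon> (tgt G g) * \<epsilon> g = \<epsilon> g"
    and b_obj: "y \<in> Obj G \<Longrightarrow> b y a = \<epsilon> y * a"
    and b_b: "\<lbrakk>g \<in> Mor G; h \<in> Mor G; src G g = tgt G h\<rbrakk> \<Longrightarrow> b g (b h a) = \<epsilon> g * b (cmp G g h) a"
    and D_eq: "g \<in> Mor G \<Longrightarrow> D g = {a. \<epsilon> g * a = a}"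
    and the_alpha: "g \<in> Mor G \<Longrightarrow> the (\<alpha> g (a * rng_one (D (ginv G g)))) = b g a"
begin

abbreviation "R \<equiv> skew_ring G D \<alpha>"

section \<open>Consequences of the composition law for the total maps\<close>

lemma rng_one_D:
  assumes g: "g \<in> Mor G" shows "rng_one (D g) = \<epsilon> g"
proof (rule rng_oneI)
  have "a * \<epsilon> g = a" if "\<epsilon> g * a = a" for a
    using central[OF g, of a] that by simp
  then show "is_rng_one (D g) (\<epsilon> g)"
    using g idem by (auto simp: is_rng_one_def D_eq)
qed

lemma b_zero: "g \<in> Mor G \<Longrightarrow> b g 0 = 0"
  using b_add[of g 0 0] by simp

lemma b_sum: "g \<in> Mor G \<Longrightarrow> b g (sum f X) = (\<Sum>x\<in>X. b g (f x))"
  by (induction X rule: infinite_finite_induct) (simp_all add: b_zero b_add)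

lemma left_central: "g \<in> Mor G \<Longrightarrow> \<epsilon> g * (a * c) = a * (\<epsilon> g * c)"
  using central[of g a] by (simp flip: mult.assoc)

text \<open>With \<open>h\<close> inverse to \<open>g\<close> the law \<open>b_b\<close> leaves two
  idempotents in front of \<open>a\<close>, and \<open>eps_tgt\<close> absorbs one of them.\<close>

lemma b_b_ginv:
  assumes g: "g \<in> Mor G" and a: "\<epsilon> g * a = a"
  shows "b g (b (ginv G g) a) = a"
proof -
  have "b g (b (ginv G g) a) = \<epsilon> (tgt G g) * \<epsilon> g * a"
    using g by (simp add: b_b b_obj left_central mult.assoc)
  then show ?thesis using g a by (simp add: eps_tgt)
qed

text \<open>Pulling \<open>a\<close> back along \<open>h\<close> writes \<open>b g a\<close> as a
  multiple of a value of \<open>b (cmp G g h)\<close>. This is why products of homogeneous elements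
  have their coefficient in the right ideal.\<close>

lemma eps_cmp_b:
  assumes "g \<in> Mor G" "h \<in> Mor G" "src G g = tgt G h" "\<epsilon> h * a = a"
  shows "\<epsilon> (cmp G g h) * b g a = b g a"
proof -
  define c where "c = b (ginv G h) a"
  have "a = b h c" using b_b_ginv assms by (simp add: c_def)
  then have "b g a = \<epsilon> g * b (cmp G g h) c" using b_b assms by simp
  then show ?thesis using assms by (simp add: left_central cmp_closed eps_b)
qed

text \<open>The right unit law for one coefficient. With \<open>a = b g c\<close>, multiplicativity
  moves the idempotent inside, where it acts as \<open>b (src G g)\<close>, and \<open>b_b\<close>
  absorbs that map.\<close>

lemma mult_b_eps_src:
  assumes g: "g \<in> Mor G" and a: "\<epsilon> g * a = a"
  shows "a * b g (\<epsilon> (src G g)) = a"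
proof -
  define c where "c = b (ginv G g) a"
  have c: "a = b g c" using b_b_ginv assms by (simp add: c_def)
  have "a * b g (\<epsilon> (src G g)) = b g (b (src G g) c)"
    unfolding c using g central[of "src G g" c] by (simp add: b_obj src_closed flip: b_mult)
  also have "\<dots> = \<epsilon> g * b g c"
    using g by (simp add: b_b src_closed tgt_src cmp_src)
  finally show ?thesis using a c by simp
qed

text \<open>The coefficient of the product of the two homogeneous elements with identity
  coefficients at \<open>g\<close> and its inverse. The preimage \<open>c\<close> of
  \<open>\<epsilon> g\<close> lies in the ideal at the inverse, whose identity fixes it.\<close>

lemma eps_mult_b_eps_ginv:
  assumes g: "g \<in> Mor G"
  shows "\<epsilon> g * b g (\<epsilon> (ginv G g)) = \<epsilon> g"
proof -
  define c where "c = b (ginv G g) (\<epsilon> g)"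
  have c: "b g c = \<epsilon> g" using b_b_ginv g idem by (simp add: c_def)
  have "\<epsilon> g * b g (\<epsilon> (ginv G g)) = b g (\<epsilon> (ginv G g) * c)"
    using g by (simp add: b_mult c central)
  also have "\<epsilon> (ginv G g) * c = c" using g by (simp add: c_def eps_b)
  finally show ?thesis by (simp add: c)
qed

section \<open>The skew groupoid ring is associative and unital\<close>

lemma carrier_iff:
  "f \<in> carrier R \<longleftrightarrow> (\<forall>g\<in>Mor G. \<epsilon> g * f g = f g) \<and> (\<forall>g. g \<notin> Mor G \<longrightarrow> f g = 0)"
  by (auto simp: skew_ring_def D_eq intro: finite_subset[OF _ finite_Mor])

lemma skew_simps [simp]:
  "\<zero>\<^bsub>R\<^esub> = (\<lambda>g. 0)" "f \<oplus>\<^bsub>R\<^esub> f' = (\<lambda>g. f g + f' g)"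
  by (simp_all add: skew_ring_def)

text \<open>A factorisation of \<open>k\<close> is determined by its first factor \<open>g\<close>.
  The pairs with a zero coefficient, which the definition leaves out, contribute nothing since
  \<open>b g 0 = 0\<close>.\<close>

lemma mult_eq:
  "f \<otimes>\<^bsub>R\<^esub> f' = (\<lambda>k. if k \<in> Mor G
     then \<Sum>g | g \<in> Mor G \<and> tgt G g = tgt G k. f g * b g (f' (cmp G (ginv G g) k)) else 0)"
proof
  fix k
  let ?P = "{(g, h). g \<in> Mor G \<and> h \<in> Mor G \<and> f g \<noteq> 0 \<and> f' h \<noteq> 0 \<and> src G g = tgt G h \<and> cmp G g h = k}"
  let ?Q = "{(g, h). g \<in> Mor G \<and> h \<in> Mor G \<and> src G g = tgt G h \<and> cmp G g h = k}"
  have mult: "(f \<otimes>\<^bsub>R\<^esub> f') k = (\<Sum>(g, h)\<in>?P. f g * b g (f' h))"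
    by (auto simp: skew_ring_def the_alpha intro!: sum.cong)
  show "(f \<otimes>\<^bsub>R\<^esub> f') k = (if k \<in> Mor G
     then \<Sum>g | g \<in> Mor G \<and> tgt G g = tgt G k. f g * b g (f' (cmp G (ginv G g) k)) else 0)"
  proof (cases "k \<in> Mor G")
    case True
    have "finite ?Q" by (rule finite_subset[of _ "Mor G \<times> Mor G"]) (auto simp: finite_Mor)
    then have "(\<Sum>(g, h)\<in>?P. f g * b g (f' h)) = (\<Sum>(g, h)\<in>?Q. f g * b g (f' h))"
      by (intro sum.mono_neutral_left) (auto simp: b_zero)
    also have "\<dots> = (\<Sum>g | g \<in> Mor G \<and> tgt G g = tgt G k. f g * b g (f' (cmp G (ginv G g) k)))"
      by (rule sum.reindex_bij_witness[of _ "\<lambda>g. (g, cmp G (ginv G g) k)" fst])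
        (use True in \<open>auto simp: cmp_closed tgt_cmp cmp_ginv_cancel ginv_cmp_cancel\<close>)
    finally show ?thesis using True mult by simp
  next
    case False
    then have "?P = {}" by (auto simp: cmp_closed)
    then show ?thesis unfolding mult using False by (simp only: sum.empty if_False)
  qed
qed

text \<open>A partial sum of the identity of \<open>R\<close>: all of \<open>Obj G\<close> gives the
  identity itself and \<open>{x}\<close> the corner idempotent, so one computation of products
  serves both.\<close>

definition local_one :: "'g set \<Rightarrow> 'g \<Rightarrow> 'a" where
  "local_one Z = (\<lambda>g. if g \<in> Z then \<epsilon> g else 0)"

lemma local_one_closed: "Z \<subseteq> Obj G \<Longrightarrow> local_one Z \<in> carrier R"
  by (auto simp: carrier_iff local_one_def idem Obj_simps(1))

lemma one_eq: "\<one>\<^bsub>R\<^esub> = local_one (Obj G)"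
  by (auto simp: skew_ring_def local_one_def rng_one_D Obj_simps(1))

text \<open>An identity morphism with the same target as \<open>k\<close> is \<open>tgt G k\<close>,
  so one summand survives, and \<open>\<epsilon> (tgt G k)\<close> fixes the elements of
  \<open>D k\<close>.\<close>

lemma local_one_mult:
  assumes f: "f \<in> carrier R" and Z: "Z \<subseteq> Obj G"
  shows "local_one Z \<otimes>\<^bsub>R\<^esub> f = (\<lambda>k. if k \<in> Mor G \<and> tgt G k \<in> Z then f k else 0)"
proof
  fix k
  show "(local_one Z \<otimes>\<^bsub>R\<^esub> f) k = (if k \<in> Mor G \<and> tgt G k \<in> Z then f k else 0)"
  proof (cases "k \<in> Mor G")
    case k: True
    have "(local_one Z \<otimes>\<^bsub>R\<^esub> f) k
        = (\<Sum>g | g \<in> Mor G \<and> tgt G g = tgt G k. local_one Z g * b g (f (cmp G (ginv G g) k)))"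
      using k by (simp add: mult_eq)
    also have "\<dots> = (\<Sum>g\<in>{tgt G k}. local_one Z g * b g (f (cmp G (ginv G g) k)))"
    proof (rule sum.mono_neutral_right)
      show "\<forall>g\<in>{g. g \<in> Mor G \<and> tgt G g = tgt G k} - {tgt G k}.
          local_one Z g * b g (f (cmp G (ginv G g) k)) = 0"
        using Z Obj_simps(3) by (auto simp: local_one_def)
    qed (use k in \<open>auto simp: finite_Mor tgt_closed tgt_tgt\<close>)
    finally have "(local_one Z \<otimes>\<^bsub>R\<^esub> f) k = \<dots>" .
    moreover have "\<epsilon> (tgt G k) * f k = f k"
      using f k eps_tgt[OF k] by (metis carrier_iff mult.assoc)
    ultimately show ?thesis
      using k by (simp add: local_one_def b_obj Obj_simps(4) cmp_tgt)
  qed (simp add: mult_eq)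
qed

lemma mult_local_one:
  assumes f: "f \<in> carrier R" and Z: "Z \<subseteq> Obj G"
  shows "f \<otimes>\<^bsub>R\<^esub> local_one Z = (\<lambda>k. if k \<in> Mor G \<and> src G k \<in> Z then f k else 0)"
proof
  fix k
  show "(f \<otimes>\<^bsub>R\<^esub> local_one Z) k = (if k \<in> Mor G \<and> src G k \<in> Z then f k else 0)"
  proof (cases "k \<in> Mor G")
    case k: True
    \<comment> \<open>The second factor is evaluated at the inverse of \<open>g\<close> times
      \<open>k\<close>, which is an identity morphism only for \<open>g = k\<close>, so the sum
      collapses to that term.\<close>
    have zero: "local_one Z (cmp G (ginv G g) k) = 0"
      if g: "g \<in> Mor G" "tgt G g = tgt G k" "g \<noteq> k" for g
    proof -
      have "cmp G (ginv G g) k \<notin> Obj G"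
      proof
        assume o: "cmp G (ginv G g) k \<in> Obj G"
        have "cmp G (ginv G g) k = src G g"
          using Obj_simps(3)[OF o] g k by (simp add: tgt_cmp)
        then have "k = cmp G g (src G g)" using cmp_ginv_cancel[of g k] g k by simp
        then show False using g by (simp add: cmp_src)
      qed
      then show ?thesis using Z by (auto simp: local_one_def)
    qed
    have "(f \<otimes>\<^bsub>R\<^esub> local_one Z) k
        = (\<Sum>g | g \<in> Mor G \<and> tgt G g = tgt G k. f g * b g (local_one Z (cmp G (ginv G g) k)))"
      using k by (simp add: mult_eq)
    also have "\<dots> = (\<Sum>g\<in>{k}. f g * b g (local_one Z (cmp G (ginv G g) k)))"
      by (rule sum.mono_neutral_right) (use k zero in \<open>auto simp: finite_Mor b_zero\<close>)
    finally have "(f \<otimes>\<^bsub>R\<^esub> local_one Z) k = \<dots>" .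
    moreover have "f k * b k (\<epsilon> (src G k)) = f k"
      using f k by (intro mult_b_eps_src) (auto simp: carrier_iff)
    ultimately show ?thesis
      using k by (simp add: local_one_def b_zero)
  qed (simp add: mult_eq)
qed

lemma mult_closed:
  assumes f: "f \<in> carrier R" "f' \<in> carrier R"
  shows "f \<otimes>\<^bsub>R\<^esub> f' \<in> carrier R"
  unfolding carrier_iff
proof (intro conjI ballI allI impI)
  fix k assume k: "k \<in> Mor G"
  have "\<epsilon> k * (f g * b g (f' (cmp G (ginv G g) k))) = f g * b g (f' (cmp G (ginv G g) k))"
    if g: "g \<in> Mor G" "tgt G g = tgt G k" for g
    using eps_cmp_b[of g "cmp G (ginv G g) k"] f(2) g k
    by (simp add: left_central carrier_iff cmp_closed tgt_cmp cmp_ginv_cancel)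
  then show "\<epsilon> k * (f \<otimes>\<^bsub>R\<^esub> f') k = (f \<otimes>\<^bsub>R\<^esub> f') k"
    using k by (simp add: mult_eq sum_distrib_left)
qed (simp add: mult_eq)

text \<open>Both sides become double sums over \<open>p\<close> and \<open>g\<close> in
  \<open>T\<close>, where \<open>k\<close> splits as \<open>g\<close>, then the inverse of
  \<open>g\<close> times \<open>p\<close>, then the inverse of \<open>p\<close> times
  \<open>k\<close>. On the right-hand side \<open>b_b\<close> produces an extra factor
  \<open>\<epsilon> g\<close>, and the coefficient \<open>f g\<close> absorbs it because it lies in
  \<open>D g\<close>.\<close>

lemma mult_assoc:
  assumes f: "f \<in> carrier R" "f' \<in> carrier R" "f'' \<in> carrier R"
  shows "f \<otimes>\<^bsub>R\<^esub> f' \<otimes>\<^bsub>R\<^esub> f'' = f \<otimes>\<^bsub>R\<^esub> (f' \<otimes>\<^bsub>R\<^esub> f'')"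
proof
  fix k
  show "(f \<otimes>\<^bsub>R\<^esub> f' \<otimes>\<^bsub>R\<^esub> f'') k = (f \<otimes>\<^bsub>R\<^esub> (f' \<otimes>\<^bsub>R\<^esub> f'')) k"
  proof (cases "k \<in> Mor G")
    case k: True
    define T where "T = {g \<in> Mor G. tgt G g = tgt G k}"
    have T_eq: "{g. g \<in> Mor G \<and> tgt G g = tgt G p} = T" if "p \<in> T" for p
      using that by (auto simp: T_def)
    have TM: "p \<in> Mor G" if "p \<in> T" for p
      using that by (simp add: T_def)
    \<comment> \<open>\<open>d g p\<close> is the unique morphism whose composite with
      \<open>g\<close> on its left is \<open>p\<close>; the identity \<open>dd\<close> below matches
      the last factors of the two ways to split \<open>k\<close>.\<close>
    define d where "d g p = cmp G (ginv G g) p" for g p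
    have "(f \<otimes>\<^bsub>R\<^esub> f' \<otimes>\<^bsub>R\<^esub> f'') k = (\<Sum>p\<in>T. \<Sum>g\<in>T. f g * b g (f' (d g p)) * b p (f'' (d p k)))"
    proof -
      have "(f \<otimes>\<^bsub>R\<^esub> f') p = (\<Sum>g\<in>T. f g * b g (f' (d g p)))" if "p \<in> T" for p
        using that T_eq TM unfolding mult_eq d_def by simp
      moreover have "(f \<otimes>\<^bsub>R\<^esub> f' \<otimes>\<^bsub>R\<^esub> f'') k = (\<Sum>p\<in>T. (f \<otimes>\<^bsub>R\<^esub> f') p * b p (f'' (d p k)))"
        using k by (subst mult_eq) (simp add: T_def d_def)
      ultimately show ?thesis by (simp add: sum_distrib_right)
    qed
    also have "\<dots> = (\<Sum>g\<in>T. f g * (\<Sum>p\<in>T. b g (f' (d g p)) * b p (f'' (d p k))))"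
      by (subst sum.swap) (simp add: sum_distrib_left mult.assoc)
    also have "\<dots> = (\<Sum>g\<in>T. f g * b g ((f' \<otimes>\<^bsub>R\<^esub> f'') (d g k)))"
    proof (rule sum.cong[OF refl])
      fix g assume g: "g \<in> T"
      then have gM: "g \<in> Mor G" and gk: "tgt G g = tgt G k" by (auto simp: T_def)
      have bij: "bij_betw (d g) T {h \<in> Mor G. tgt G h = src G g}"
        using bij_betw_left_translation[OF gM] by (simp add: T_def gk d_def[abs_def])
      have dk: "d g k \<in> Mor G" "tgt G (d g k) = src G g"
        using gM gk k by (auto simp: d_def cmp_closed tgt_cmp)
      have dd: "d (d g p) (d g k) = d p k" if "p \<in> T" for p
      proof -
        have p: "p \<in> Mor G" "tgt G p = tgt G k" using that by (auto simp: T_def)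
        have "ginv G (d g p) = cmp G (ginv G p) g"
          using gM gk p by (simp add: d_def ginv_cmp)
        then have "d (d g p) (d g k) = cmp G (ginv G p) (cmp G g (d g k))"
          using gM gk p dk by (simp add: d_def[of "d g p"] cmp_assoc)
        then show ?thesis using gM gk k by (simp add: d_def cmp_ginv_cancel)
      qed
      have "b g ((f' \<otimes>\<^bsub>R\<^esub> f'') (d g k))
          = b g (\<Sum>h | h \<in> Mor G \<and> tgt G h = src G g. f' h * b h (f'' (d h (d g k))))"
        using dk by (simp add: mult_eq d_def)
      also have "\<dots> = b g (\<Sum>p\<in>T. f' (d g p) * b (d g p) (f'' (d p k)))"
        by (simp add: dd flip: sum.reindex_bij_betw[OF bij] cong: sum.cong)
      also have "\<dots> = (\<Sum>p\<in>T. b g (f' (d g p)) * b g (b (d g p) (f'' (d p k))))"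
        using gM by (simp add: b_sum b_mult)
      also have "\<dots> = (\<Sum>p\<in>T. b g (f' (d g p)) * (\<epsilon> g * b p (f'' (d p k))))"
        by (rule sum.cong[OF refl])
          (use gM gk in \<open>auto simp: T_def d_def b_b cmp_closed tgt_cmp cmp_ginv_cancel\<close>)
      also have "\<dots> = \<epsilon> g * (\<Sum>p\<in>T. b g (f' (d g p)) * b p (f'' (d p k)))"
        using gM by (simp add: sum_distrib_left left_central)
      finally show "f g * (\<Sum>p\<in>T. b g (f' (d g p)) * b p (f'' (d p k)))
          = f g * b g ((f' \<otimes>\<^bsub>R\<^esub> f'') (d g k))"
        using f(1) gM central[OF gM, of "f g"] by (simp add: carrier_iff flip: mult.assoc)
    qed
    also have "\<dots> = (f \<otimes>\<^bsub>R\<^esub> (f' \<otimes>\<^bsub>R\<^esub> f'')) k"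
      using k by (subst (2) mult_eq) (simp add: T_def d_def)
    finally show ?thesis .
  qed (simp add: mult_eq)
qed

lemma ring_skew_ring: "ring R"
proof (intro ringI abelian_groupI monoidI)
  show "\<exists>f'\<in>carrier R. f' \<oplus>\<^bsub>R\<^esub> f = \<zero>\<^bsub>R\<^esub>" if "f \<in> carrier R" for f
    by (rule bexI[of _ "\<lambda>g. - f g"]) (use that in \<open>auto simp: carrier_iff\<close>)
  have one: "(\<lambda>k. if k \<in> Mor G \<and> tgt G k \<in> Obj G then f k else 0) = f"
    "(\<lambda>k. if k \<in> Mor G \<and> src G k \<in> Obj G then f k else 0) = f" if "f \<in> carrier R" for f
    using that by (auto simp: carrier_iff)
  show "\<one>\<^bsub>R\<^esub> \<otimes>\<^bsub>R\<^esub> f = f" "f \<otimes>\<^bsub>R\<^esub> \<one>\<^bsub>R\<^esub> = f" if "f \<in> carrier R" for f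
    using local_one_mult[OF that subset_refl] mult_local_one[OF that subset_refl] one[OF that]
    by (simp_all only: one_eq)
  show "f \<otimes>\<^bsub>R\<^esub> f' \<in> carrier R" if "f \<in> carrier R" "f' \<in> carrier R" for f f'
    by (rule mult_closed[OF that])
  show "f \<otimes>\<^bsub>R\<^esub> f' \<otimes>\<^bsub>R\<^esub> f'' = f \<otimes>\<^bsub>R\<^esub> (f' \<otimes>\<^bsub>R\<^esub> f'')"
    if "f \<in> carrier R" "f' \<in> carrier R" "f'' \<in> carrier R" for f f' f''
    by (rule mult_assoc[OF that])
  show "\<one>\<^bsub>R\<^esub> \<in> carrier R" by (simp add: one_eq local_one_closed)
  show "(f \<oplus>\<^bsub>R\<^esub> f') \<otimes>\<^bsub>R\<^esub> f'' = f \<otimes>\<^bsub>R\<^esub> f'' \<oplus>\<^bsub>R\<^esub> f' \<otimes>\<^bsub>R\<^esub> f''"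
    "f'' \<otimes>\<^bsub>R\<^esub> (f \<oplus>\<^bsub>R\<^esub> f') = f'' \<otimes>\<^bsub>R\<^esub> f \<oplus>\<^bsub>R\<^esub> f'' \<otimes>\<^bsub>R\<^esub> f'" for f f' f''
    by (auto simp: mult_eq distrib_left distrib_right b_add sum.distrib)
qed (auto simp: carrier_iff distrib_left add_ac)

section \<open>The corner idempotent generates the whole ring\<close>

definition single :: "'g \<Rightarrow> 'a \<Rightarrow> 'g \<Rightarrow> 'a" where
  "single g a = (\<lambda>k. if k = g then a else 0)"

lemma single_closed: "\<lbrakk>g \<in> Mor G; \<epsilon> g * a = a\<rbrakk> \<Longrightarrow> single g a \<in> carrier R"
  by (auto simp: carrier_iff single_def)

lemma single_mult_single_ginv:
  assumes g: "g \<in> Mor G"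
  shows "single g (\<epsilon> g) \<otimes>\<^bsub>R\<^esub> single (ginv G g) (\<epsilon> (ginv G g)) = single (tgt G g) (\<epsilon> g)"
proof
  fix k
  show "(single g (\<epsilon> g) \<otimes>\<^bsub>R\<^esub> single (ginv G g) (\<epsilon> (ginv G g))) k = single (tgt G g) (\<epsilon> g) k"
  proof (cases "k \<in> Mor G \<and> tgt G k = tgt G g")
    case True
    then have k: "k \<in> Mor G" "tgt G k = tgt G g" by auto
    let ?s = "\<lambda>p. single g (\<epsilon> g) p * b p (single (ginv G g) (\<epsilon> (ginv G g)) (cmp G (ginv G p) k))"
    have "(single g (\<epsilon> g) \<otimes>\<^bsub>R\<^esub> single (ginv G g) (\<epsilon> (ginv G g))) k
        = (\<Sum>p | p \<in> Mor G \<and> tgt G p = tgt G k. ?s p)"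
      using k by (simp add: mult_eq)
    also have "\<dots> = (\<Sum>p\<in>{g}. ?s p)"
      by (rule sum.mono_neutral_right) (use k g in \<open>auto simp: finite_Mor single_def\<close>)
    finally have "(single g (\<epsilon> g) \<otimes>\<^bsub>R\<^esub> single (ginv G g) (\<epsilon> (ginv G g))) k = \<dots>" .
    moreover have "cmp G (ginv G g) k = ginv G g \<longleftrightarrow> k = tgt G g"
    proof
      assume "cmp G (ginv G g) k = ginv G g"
      then show "k = tgt G g" using cmp_ginv_cancel[of g k] g k by simp
    next
      assume "k = tgt G g"
      then show "cmp G (ginv G g) k = ginv G g" using cmp_src[of "ginv G g"] g by simp
    qed
    ultimately show ?thesis using g by (simp add: single_def eps_mult_b_eps_ginv b_zero)
  next
    case False
    then have "tgt G g \<noteq> k" using g by (auto simp: tgt_closed tgt_tgt)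
    moreover have "(single g (\<epsilon> g) \<otimes>\<^bsub>R\<^esub> single (ginv G g) (\<epsilon> (ginv G g))) k = 0"
      unfolding mult_eq using False by (auto simp: single_def intro!: sum.neutral)
    ultimately show ?thesis by (simp add: single_def)
  qed
qed

text \<open>For an arbitrary \<open>g\<close> from \<open>x\<close> to \<open>y\<close> the sandwich
  around the idempotent has coefficient \<open>\<epsilon> g\<close>, which may be a proper part of
  \<open>\<epsilon> y\<close>. The hypothesis \<open>full\<close> asks for one \<open>g\<close>
  where nothing is lost.\<close>

lemma Idl_local_one:
  assumes x: "x \<in> Obj G"
    and full: "\<And>y. y \<in> Obj G \<Longrightarrow> \<exists>g\<in>homset G x y. \<epsilon> g = \<epsilon> y"
  shows "Idl\<^bsub>R\<^esub> {local_one {x}} = carrier R"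
proof -
  interpret R: ring R by (rule ring_skew_ring)
  have e: "local_one {x} \<in> carrier R" using x by (intro local_one_closed) auto
  interpret J: ideal "Idl\<^bsub>R\<^esub> {local_one {x}}" R by (rule R.genideal_ideal) (use e in auto)
  have single: "local_one {y} \<in> Idl\<^bsub>R\<^esub> {local_one {x}}" if y: "y \<in> Obj G" for y
  proof -
    obtain g where g: "g \<in> Mor G" "src G g = x" "tgt G g = y" "\<epsilon> g = \<epsilon> y"
      using full[OF y] by (auto simp: homset_def)
    have c: "single g (\<epsilon> g) \<in> carrier R" "single (ginv G g) (\<epsilon> (ginv G g)) \<in> carrier R"
      using g(1) by (intro single_closed idem ginv_simps; assumption)+
    have "single g (\<epsilon> g) \<otimes>\<^bsub>R\<^esub> local_one {x} = single g (\<epsilon> g)"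
      using g x by (subst mult_local_one[OF c(1)]) (auto simp: single_def)
    then have "local_one {y} = single g (\<epsilon> g) \<otimes>\<^bsub>R\<^esub> local_one {x} \<otimes>\<^bsub>R\<^esub> single (ginv G g) (\<epsilon> (ginv G g))"
      using single_mult_single_ginv[OF g(1)] g(3,4) by (auto simp: single_def[of y] local_one_def)
    also have "\<dots> \<in> Idl\<^bsub>R\<^esub> {local_one {x}}"
      by (intro J.I_l_closed J.I_r_closed c R.genideal_self' e)
    finally show ?thesis .
  qed
  have "local_one Z \<in> Idl\<^bsub>R\<^esub> {local_one {x}}" if "finite Z" "Z \<subseteq> Obj G" for Z
    using that
  proof (induction Z)
    case empty
    have "local_one {} = \<zero>\<^bsub>R\<^esub>" by (simp add: local_one_def)
    then show ?case using J.zero_closed by simp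
  next
    case (insert y Z)
    have "local_one (insert y Z) = local_one {y} \<oplus>\<^bsub>R\<^esub> local_one Z"
      using insert(2) by (auto simp: local_one_def)
    then show ?case using insert single J.a_closed by simp
  qed
  moreover have "finite (Obj G)" using finite_Mor by (simp add: Obj_def)
  ultimately have "\<one>\<^bsub>R\<^esub> \<in> Idl\<^bsub>R\<^esub> {local_one {x}}" by (simp add: one_eq)
  then show ?thesis by (rule J.one_imp_carrier)
qed

end

section \<open>The isotropy group\<close>

lemma isotropy_simps [simp]:
  "Mor (isotropy G x) = homset G x x" "src (isotropy G x) = src G" "tgt (isotropy G x) = tgt G"
  "cmp (isotropy G x) = cmp G"
  by (simp_all add: isotropy_def)

lemma ginv_isotropy:
  assumes "h \<in> homset G x x" shows "ginv (isotropy G x) h = ginv G h"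
proof -
  have "is_inverse (isotropy G x) h = is_inverse G h"
    using assms by (auto simp: fun_eq_iff is_inverse_def homset_def)
  then show ?thesis by (simp add: ginv_def)
qed

lemma (in groupoid) Obj_isotropy:
  assumes "x \<in> Obj G" shows "Obj (isotropy G x) = {x}"
  using Obj_simps[OF assms] by (auto simp: Obj_def homset_def intro!: image_eqI[of _ _ x])

context total_partial_action
begin

text \<open>The idempotent on the left keeps the morphisms that end at \<open>x\<close>, on the
  right those that start at \<open>x\<close>; together they leave the functions supported on the
  isotropy group.\<close>

lemma corner_ring_isotropy:
  assumes x: "x \<in> Obj G"
  shows "corner_ring R (local_one {x}) (skew_ring (isotropy G x) D \<alpha>)"
proof -
  let ?S = "skew_ring (isotropy G x) D \<alpha>"
  interpret R: ring R by (rule ring_skew_ring)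
  have xs: "{x} \<subseteq> Obj G" using x by simp
  have e: "local_one {x} \<in> carrier R" by (rule local_one_closed[OF xs])
  have corner: "local_one {x} \<otimes>\<^bsub>R\<^esub> f \<otimes>\<^bsub>R\<^esub> local_one {x} = (\<lambda>k. if k \<in> homset G x x then f k else 0)"
    if f: "f \<in> carrier R" for f
  proof -
    have "local_one {x} \<otimes>\<^bsub>R\<^esub> f \<otimes>\<^bsub>R\<^esub> local_one {x}
        = (\<lambda>k. if k \<in> Mor G \<and> src G k \<in> {x} then (local_one {x} \<otimes>\<^bsub>R\<^esub> f) k else 0)"
      by (rule mult_local_one[OF mult_closed[OF e f] xs])
    then show ?thesis
      unfolding local_one_mult[OF f xs] by (auto simp: fun_eq_iff homset_def)
  qed
  have S_iff: "f \<in> carrier ?S \<longleftrightarrow> (\<forall>g\<in>homset G x x. \<epsilon> g * f g = f g) \<and> (\<forall>g. g \<notin> homset G x x \<longrightarrow> f g = 0)"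
    for f
    using D_eq
    by (auto simp: skew_ring_def homset_def intro!: finite_subset[OF _ finite_Mor])
  show ?thesis
  proof unfold_locales
    show "local_one {x} \<in> carrier R" by (rule e)
    show "local_one {x} \<otimes>\<^bsub>R\<^esub> local_one {x} = local_one {x}"
      unfolding local_one_mult[OF e xs] using Obj_simps[OF x] by (auto simp: local_one_def)
    show "carrier ?S = {local_one {x} \<otimes>\<^bsub>R\<^esub> r \<otimes>\<^bsub>R\<^esub> local_one {x} |r. r \<in> carrier R}"
    proof (intro equalityI subsetI)
      fix f assume f: "f \<in> carrier ?S"
      then have "f \<in> carrier R"
        unfolding S_iff carrier_iff by (metis (no_types, lifting) homset_def mem_Collect_eq mult_zero_right)
      moreover from this f have "f = local_one {x} \<otimes>\<^bsub>R\<^esub> f \<otimes>\<^bsub>R\<^esub> local_one {x}"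
        by (auto simp: corner S_iff)
      ultimately show "f \<in> {local_one {x} \<otimes>\<^bsub>R\<^esub> r \<otimes>\<^bsub>R\<^esub> local_one {x} |r. r \<in> carrier R}" by blast
    next
      fix f assume "f \<in> {local_one {x} \<otimes>\<^bsub>R\<^esub> r \<otimes>\<^bsub>R\<^esub> local_one {x} |r. r \<in> carrier R}"
      then obtain r where r: "r \<in> carrier R" "f = (\<lambda>k. if k \<in> homset G x x then r k else 0)"
        using corner by auto
      then show "f \<in> carrier ?S" by (simp add: S_iff carrier_iff homset_def)
    qed
    show "f \<otimes>\<^bsub>?S\<^esub> f' = f \<otimes>\<^bsub>R\<^esub> f'" if f: "f \<in> carrier ?S" "f' \<in> carrier ?S" for f f'
    proof
      fix k
      \<comment> \<open>The restriction to nonzero coefficients in \<open>skew_ring\<close> makes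
        the two index sets equal, as \<open>f\<close> and \<open>f'\<close> vanish outside the
        isotropy group.\<close>
      have "{(g, h). g \<in> homset G x x \<and> h \<in> homset G x x \<and> f g \<noteq> 0 \<and> f' h \<noteq> 0 \<and> src G g = tgt G h \<and> cmp G g h = k}
          = {(g, h). g \<in> Mor G \<and> h \<in> Mor G \<and> f g \<noteq> 0 \<and> f' h \<noteq> 0 \<and> src G g = tgt G h \<and> cmp G g h = k}"
        using f unfolding S_iff by (auto simp: homset_def)
      moreover have "ginv (isotropy G x) g = ginv G g" if "f g \<noteq> 0" for g
        using f(1) that by (metis S_iff ginv_isotropy)
      ultimately show "(f \<otimes>\<^bsub>?S\<^esub> f') k = (f \<otimes>\<^bsub>R\<^esub> f') k"
        by (auto simp: skew_ring_def intro!: sum.cong)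
    qed
    show "f \<oplus>\<^bsub>?S\<^esub> f' = f \<oplus>\<^bsub>R\<^esub> f'" for f f' by (simp add: skew_ring_def)
    show "\<zero>\<^bsub>?S\<^esub> = \<zero>\<^bsub>R\<^esub>" by (simp add: skew_ring_def)
    show "\<one>\<^bsub>?S\<^esub> = local_one {x}"
      using x by (auto simp: skew_ring_def local_one_def Obj_isotropy rng_one_D Obj_simps(1))
  qed
qed

end

section \<open>Unital partial actions\<close>

lemma rng_iso_simps:
  assumes f: "rng_iso J K f"
  shows "a \<in> J \<Longrightarrow> f a = Some (the (f a))" "a \<notin> J \<Longrightarrow> f a = None" "a \<in> J \<Longrightarrow> the (f a) \<in> K"
    "\<lbrakk>a \<in> J; b \<in> J\<rbrakk> \<Longrightarrow> the (f (a + b)) = the (f a) + the (f b)"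
    "\<lbrakk>a \<in> J; b \<in> J\<rbrakk> \<Longrightarrow> the (f (a * b)) = the (f a) * the (f b)"
  using f unfolding rng_iso_def dom_def ran_def by auto

lemma rng_iso_inj:
  assumes f: "rng_iso J K f" and "a \<in> J" "b \<in> J" "the (f a) = the (f b)"
  shows "a = b"
  using f rng_iso_simps(1)[OF f] assms(2-4) unfolding rng_iso_def by (metis inj_onD)

lemma rng_iso_surj:
  assumes f: "rng_iso J K f" and c: "c \<in> K"
  obtains a where "a \<in> J" "c = the (f a)"
proof -
  have "c \<in> ran f" using f c by (simp add: rng_iso_def)
  then obtain a where a: "f a = Some c" by (auto simp: ran_def)
  then have "a \<in> J" using f by (auto simp: rng_iso_def)
  then show thesis using a by (intro that[of a]) simp_all
qed

lemma pinv_rng_iso: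
  assumes f: "rng_iso J K f"
  shows "a \<in> J \<Longrightarrow> pinv f (the (f a)) = Some a" "c \<notin> K \<Longrightarrow> pinv f c = None"
proof -
  assume a: "a \<in> J"
  have "(THE a'. f a' = Some (the (f a))) = a"
  proof (rule the_equality)
    show "f a = Some (the (f a))" by (rule rng_iso_simps(1)[OF f a])
    show "a' = a" if "f a' = Some (the (f a))" for a'
      using that rng_iso_simps(2)[OF f, of a'] rng_iso_inj[OF f _ a, of a'] by fastforce
  qed
  moreover have "the (f a) \<in> ran f"
    using rng_iso_simps(1)[OF f a] by (metis ranI)
  ultimately show "pinv f (the (f a)) = Some a" by (simp add: pinv_def)
next
  show "c \<notin> K \<Longrightarrow> pinv f c = None" using f by (auto simp: pinv_def rng_iso_def)
qed

text \<open>This is later applied to the isotropy group with \<open>A\<close> equal to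
  \<open>I x\<close>. The identities commute with elements of \<open>A\<close> only, hence the
  membership conditions throughout.\<close>

locale unital_partial_action = groupoid H
  for H :: "('g, 'z) category_scheme" +
  fixes A :: "'a::ring set" and D :: "'g \<Rightarrow> 'a set" and \<alpha> :: "'g \<Rightarrow> 'a \<rightharpoonup> 'a"
  assumes partial_action: "partial_action H A D \<alpha>"
    and unital: "h \<in> Mor H \<Longrightarrow> \<exists>e. is_rng_one (D h) e \<and> (\<forall>r\<in>A. e * r = r * e)"
begin

definition u where "u h = rng_one (D h)"

definition val where "val g a = the (\<alpha> g a)"

definition tmap where "tmap g a = val g (a * u (ginv H g))"

lemma is_rng_one_u: "h \<in> Mor H \<Longrightarrow> is_rng_one (D h) (u h)"
  unfolding u_def using unital rng_oneI by metis

lemma u_central: "\<lbrakk>h \<in> Mor H; r \<in> A\<rbrakk> \<Longrightarrow> u h * r = r * u h"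
  unfolding u_def using unital rng_oneI by metis

lemma u_D: "h \<in> Mor H \<Longrightarrow> u h \<in> D h"
  using is_rng_one_u by (simp add: is_rng_one_def)

lemma u_mult: "\<lbrakk>h \<in> Mor H; a \<in> D h\<rbrakk> \<Longrightarrow> u h * a = a"
  and mult_u: "\<lbrakk>h \<in> Mor H; a \<in> D h\<rbrakk> \<Longrightarrow> a * u h = a"
  using is_rng_one_u[of h] by (simp_all add: is_rng_one_def)

lemma subrng_A: "subrng A"
  using partial_action by (simp add: partial_action_def)

lemma rng_iso_val: "g \<in> Mor H \<Longrightarrow> rng_iso (D (ginv H g)) (D g) (\<alpha> g)"
  using partial_action by (simp add: partial_action_def)

lemma D_tgt: "h \<in> Mor H \<Longrightarrow> D h \<subseteq> D (tgt H h)"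
  and D_A: "h \<in> Mor H \<Longrightarrow> D h \<subseteq> A"
  using partial_action unfolding partial_action_def ideal_of_def by blast+

text \<open>An ideal of an ideal need not be an ideal of the whole ring. Here the identity of the
  intermediate ideal \<open>D (tgt H h)\<close> can be inserted between \<open>r\<close> and
  \<open>d\<close>, so both ideal properties apply in turn.\<close>

lemma D_absorb:
  assumes h: "h \<in> Mor H" and d: "d \<in> D h" and r: "r \<in> A"
  shows "r * d \<in> D h" "d * r \<in> D h"
proof -
  have i: "ideal_of (D (tgt H h)) A" "ideal_of (D h) (D (tgt H h))"
    using partial_action h by (auto simp: partial_action_def)
  have t: "u (tgt H h) \<in> D (tgt H h)" using u_D h by (simp add: tgt_closed)
  have "r * u (tgt H h) \<in> D (tgt H h)" "u (tgt H h) * r \<in> D (tgt H h)"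
    using i(1) t r by (auto simp: ideal_of_def)
  then have *: "r * u (tgt H h) * d \<in> D h" "d * (u (tgt H h) * r) \<in> D h"
    using i(2) d by (auto simp: ideal_of_def)
  have "u (tgt H h) * d = d" "d * u (tgt H h) = d"
    using u_mult mult_u h D_tgt[OF h] d by (auto simp: tgt_closed)
  then show "r * d \<in> D h" "d * r \<in> D h" using * by (simp_all add: mult.assoc) (simp flip: mult.assoc)
qed

lemma val_D: "\<lbrakk>g \<in> Mor H; a \<in> D (ginv H g)\<rbrakk> \<Longrightarrow> val g a \<in> D g"
  unfolding val_def by (rule rng_iso_simps(3)[OF rng_iso_val])

lemma val_mult: "\<lbrakk>g \<in> Mor H; a \<in> D (ginv H g); c \<in> D (ginv H g)\<rbrakk> \<Longrightarrow> val g (a * c) = val g a * val g c"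
  unfolding val_def by (rule rng_iso_simps(5)[OF rng_iso_val])

lemma val_add: "\<lbrakk>g \<in> Mor H; a \<in> D (ginv H g); c \<in> D (ginv H g)\<rbrakk> \<Longrightarrow> val g (a + c) = val g a + val g c"
  unfolding val_def by (rule rng_iso_simps(4)[OF rng_iso_val])

lemma val_Obj: "\<lbrakk>y \<in> Obj H; a \<in> D y\<rbrakk> \<Longrightarrow> val y a = a"
  using partial_action by (simp add: partial_action_def val_def pid_def)

lemma val_cmp:
  assumes gh: "g \<in> Mor H" "h \<in> Mor H" "src H g = tgt H h"
    and a: "a \<in> D (ginv H h)" "val h a \<in> D (ginv H g)"
  shows "a \<in> D (ginv H (cmp H g h))" "val (cmp H g h) a = val g (val h a)"
proof -
  have "(\<alpha> g \<circ>\<^sub>m \<alpha> h) \<subseteq>\<^sub>m \<alpha> (cmp H g h)"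
    using partial_action gh by (simp add: partial_action_def)
  moreover have "(\<alpha> g \<circ>\<^sub>m \<alpha> h) a = Some (val g (val h a))"
    using rng_iso_simps(1)[OF rng_iso_val[OF gh(1)] a(2)] rng_iso_simps(1)[OF rng_iso_val[OF gh(2)] a(1)]
    unfolding map_comp_def val_def by (metis option.simps(5))
  ultimately have *: "\<alpha> (cmp H g h) a = Some (val g (val h a))"
    unfolding map_le_def by (metis domI)
  then show "val (cmp H g h) a = val g (val h a)" by (simp add: val_def)
  show "a \<in> D (ginv H (cmp H g h))"
    using * rng_iso_simps(2)[OF rng_iso_val] gh by (metis cmp_closed option.distinct(1))
qed

lemma val_ginv: "\<lbrakk>g \<in> Mor H; a \<in> D g\<rbrakk> \<Longrightarrow> val g (val (ginv H g) a) = a"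
  using val_cmp(2)[of g "ginv H g" a] val_D[of "ginv H g" a] val_Obj[of "tgt H g" a] D_tgt[of g]
  by auto

text \<open>The standard identity \<open>\<alpha>\<^sub>g (D\<^sub>g\<^sub>' \<inter> D\<^sub>h) = D\<^sub>g \<inter> D\<^sub>g\<^sub>h\<close>, with \<open>g'\<close> the inverse of \<open>g\<close>,
  in terms of identity elements.\<close>

lemma val_u_mult_u:
  assumes gh: "g \<in> Mor H" "h \<in> Mor H" "src H g = tgt H h"
  shows "val g (u h * u (ginv H g)) = u g * u (cmp H g h)"
proof -
  let ?k = "cmp H g h"
  have k: "?k \<in> Mor H" "tgt H ?k = tgt H g" using gh by (simp_all add: cmp_closed tgt_cmp)
  have u_A: "u h \<in> A" if "h \<in> Mor H" for h using u_D[OF that] D_A[OF that] by blast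
  define p where "p = u h * u (ginv H g)"
  define w where "w = u g * u ?k"
  have p: "p \<in> D h" "p \<in> D (ginv H g)"
    using gh u_D D_absorb u_A by (simp_all add: p_def)
  have w: "w \<in> D g" "w \<in> D ?k"
    using gh k u_D D_absorb u_A by (simp_all add: w_def)
  define v where "v = val (ginv H h) p"
  have v: "v \<in> D (ginv H h)" "val h v = p" using val_D[of "ginv H h" p] val_ginv p gh by (simp_all add: v_def)
  have q: "val g p \<in> D g" "val g p \<in> D ?k"
    using val_D[of g p] val_cmp[of g h v] val_D[of ?k v] gh p v k by simp_all
  define z where "z = val (ginv H ?k) w"
  have z: "z \<in> D (ginv H ?k)" "val ?k z = w"
    using val_D[of "ginv H ?k" w] val_ginv w k by (simp_all add: z_def)
  have "z \<in> D (ginv H h)" "val (ginv H g) w = val h z"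
    using val_cmp[of "ginv H g" ?k z] gh k z w by (simp_all add: ginv_cmp_cancel)
  then have w': "val (ginv H g) w \<in> D h" "val (ginv H g) w \<in> D (ginv H g)"
    using val_D[of h z] val_D[of "ginv H g" w] gh w by simp_all
  \<comment> \<open>The product of \<open>val g p\<close> and \<open>w\<close> equals either factor:
    \<open>p\<close> fixes the preimage of \<open>w\<close>, and \<open>w\<close> is a product of
    identities of ideals that contain \<open>val g p\<close>.\<close>
  have "p * val (ginv H g) w = val (ginv H g) w"
    using w' gh by (simp add: p_def mult.assoc u_mult)
  then have "val g p * w = w"
    using val_mult[of g p "val (ginv H g) w"] val_ginv[of g w] p w w' gh by simp
  moreover have "val g p * w = val g p"
    using q gh k by (simp add: w_def mult_u flip: mult.assoc)
  ultimately show ?thesis by (simp add: p_def w_def)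
qed

lemma tmap_D: "\<lbrakk>g \<in> Mor H; a \<in> A\<rbrakk> \<Longrightarrow> tmap g a \<in> D g"
  unfolding tmap_def by (intro val_D D_absorb u_D) auto

lemma tmap_add: "\<lbrakk>g \<in> Mor H; a \<in> A; c \<in> A\<rbrakk> \<Longrightarrow> tmap g (a + c) = tmap g a + tmap g c"
  by (simp add: tmap_def distrib_right val_add D_absorb u_D)

lemma tmap_mult:
  assumes "g \<in> Mor H" "a \<in> A" "c \<in> A" shows "tmap g (a * c) = tmap g a * tmap g c"
proof -
  let ?u = "u (ginv H g)"
  have "(a * ?u) * (c * ?u) = a * (?u * c) * ?u" by (simp only: mult.assoc)
  also have "\<dots> = a * c * ?u"
    using assms u_central[of "ginv H g" c] mult_u[OF _ u_D, of "ginv H g"] by (simp add: mult.assoc)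
  finally have "a * c * ?u = (a * ?u) * (c * ?u)" by simp
  then show ?thesis
    using assms by (simp add: tmap_def val_mult D_absorb u_D)
qed

lemma tmap_Obj: "\<lbrakk>y \<in> Obj H; a \<in> D y\<rbrakk> \<Longrightarrow> tmap y a = a"
  by (simp add: tmap_def Obj_simps mult_u val_Obj)

text \<open>Multiplying by \<open>v\<close>, the preimage of \<open>p\<close> under
  \<open>h\<close>, moves \<open>a\<close> into the common part of the domains at \<open>h\<close>
  and \<open>?k\<close>, where the extension property compares the maps. The leftover factor
  \<open>val g p\<close> is known from \<open>val_u_mult_u\<close>, and its part \<open>u ?k\<close>
  is absorbed.\<close>

lemma tmap_tmap:
  assumes gh: "g \<in> Mor H" "h \<in> Mor H" "src H g = tgt H h" and a: "a \<in> A"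
  shows "tmap g (tmap h a) = u g * tmap (cmp H g h) a"
proof -
  let ?k = "cmp H g h"
  have k: "?k \<in> Mor H" using gh by (simp add: cmp_closed)
  define p where "p = u h * u (ginv H g)"
  have u_A: "u h \<in> A" if "h \<in> Mor H" for h using u_D[OF that] D_A[OF that] by blast
  have p: "p \<in> D h" "p \<in> D (ginv H g)"
    using gh u_D D_absorb u_A by (simp_all add: p_def)
  define v where "v = val (ginv H h) p"
  have v: "v \<in> D (ginv H h)" "val h v = p" using val_D[of "ginv H h" p] val_ginv p gh by (simp_all add: v_def)
  have vk: "v \<in> D (ginv H ?k)" "val ?k v = val g p"
    using val_cmp[of g h v] gh p v by simp_all
  have av: "a * v \<in> D (ginv H h)" "a * v \<in> D (ginv H ?k)"
    using D_absorb gh k a v vk by simp_all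
  have "tmap h a * u (ginv H g) = tmap h a * p"
    using mult_u[OF gh(2) tmap_D[OF gh(2) a]] by (simp add: p_def flip: mult.assoc)
  also have "\<dots> = val h (a * u (ginv H h) * v)"
    using gh a v by (simp add: tmap_def val_mult D_absorb u_D)
  also have "\<dots> = val h (a * v)"
    using gh v by (simp add: mult.assoc u_mult)
  finally have *: "tmap h a * u (ginv H g) = val h (a * v)" .
  have "val h (a * v) \<in> D (ginv H g)"
    unfolding *[symmetric] using gh a tmap_D[of h a] D_A[of h] D_absorb u_D by (auto simp: subset_iff)
  then have "tmap g (tmap h a) = val ?k (a * v)"
    using val_cmp[of g h "a * v"] gh av by (simp add: tmap_def[of g] *)
  also have "\<dots> = val ?k (a * u (ginv H ?k) * v)"
    using k vk by (simp add: mult.assoc u_mult)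
  also have "\<dots> = tmap ?k a * val g p"
    using k a vk by (simp add: tmap_def val_mult D_absorb u_D)
  also have "\<dots> = tmap ?k a * u g * u ?k"
    using val_u_mult_u[OF gh] by (simp add: p_def mult.assoc)
  also have "tmap ?k a * u g = u g * tmap ?k a"
    using u_central[OF gh(1)] tmap_D[OF k a] D_A[OF k] by auto
  finally show ?thesis
    using mult_u[OF k tmap_D[OF k a]] by (simp add: mult.assoc)
qed

end

section \<open>Lifted partial actions\<close>

text \<open>Globality is built into \<open>iso\<close>, which takes \<open>I x\<close> and
  \<open>I y\<close> instead of the possibly smaller ideals indexed by the transversal.\<close>

locale lifted_action = groupoid G
  for G :: "('g, 'z) category_scheme" +
  fixes x :: 'g and \<tau> :: "'g \<Rightarrow> 'g" and I :: "'g \<Rightarrow> 'a::ring set" and \<gamma> :: "'g \<Rightarrow> 'a \<rightharpoonup> 'a"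
  assumes finite_Mor: "finite (Mor G)"
    and x: "x \<in> Obj G"
    and transversal: "transversal G x \<tau>"
    and ideal: "y \<in> Obj G \<Longrightarrow> ideal_of (I y) UNIV"
    and iso: "y \<in> Obj G \<Longrightarrow> rng_iso (I x) (I y) (\<gamma> (\<tau> y))"
    and unital_action: "unital_partial_action (isotropy G x) (I x) I \<gamma>"
begin

sublocale H: unital_partial_action "isotropy G x" "I x" I \<gamma>
  by (rule unital_action)

abbreviation "L \<equiv> to_loop G \<tau>"

abbreviation "\<beta> \<equiv> lifted G \<tau> I \<gamma>"

abbreviation "B \<equiv> \<lambda>g. ran (\<beta> g)"

definition \<phi> where "\<phi> y a = the (\<gamma> (\<tau> y) a)"

text \<open>Projection of the whole ring onto \<open>I y\<close> followed by the inverse of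
  \<open>\<phi> y\<close>: a total left inverse of \<open>\<phi> y\<close> on
  \<open>I x\<close>.\<close>

definition \<psi> where "\<psi> y a = the (pinv (\<gamma> (\<tau> y)) (a * \<phi> y (H.u x)))"

definition \<epsilon> where "\<epsilon> g = \<phi> (tgt G g) (H.u (L g))"

text \<open>The composite that defines \<open>lifted\<close>, with total maps in place of partial
  ones. At an identity \<open>y\<close> the loop is \<open>x\<close> and the formula becomes
  multiplication by \<open>\<epsilon> y\<close>, in accordance with the separate case of
  \<open>lifted\<close>.\<close>

definition b where "b g a = \<phi> (tgt G g) (H.tmap (L g) (\<psi> (src G g) a))"

section \<open>Loops and the isomorphisms along the transversal\<close>

lemma tau [simp]:
  assumes "y \<in> Obj G" shows "\<tau> y \<in> Mor G" "src G (\<tau> y) = x" "tgt G (\<tau> y) = y"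
  using transversal assms by (auto simp: transversal_def homset_def)

lemma tau_x: "\<tau> x = x"
  using transversal by (simp add: transversal_def)

lemma x_homset: "x \<in> homset G x x"
  using Obj_simps[OF x] by (simp add: homset_def)

lemma L_homset: "g \<in> Mor G \<Longrightarrow> L g \<in> homset G x x"
  by (simp add: to_loop_def homset_def cmp_closed src_cmp tgt_cmp)

lemma L_Obj: "y \<in> Obj G \<Longrightarrow> L y = x"
  using cmp_src[of "ginv G (\<tau> y)"] by (simp add: to_loop_def Obj_simps)

lemma L_tau: "y \<in> Obj G \<Longrightarrow> L (\<tau> y) = x"
  using Obj_simps[OF x] cmp_src[of x] by (simp add: to_loop_def tau_x)

text \<open>The two transversal elements at the middle object cancel, so \<open>L\<close> is
  functorial; this lets \<open>tmap_tmap\<close> pass from the isotropy group to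
  \<open>G\<close>.\<close>

lemma L_cmp:
  assumes "g \<in> Mor G" "h \<in> Mor G" "src G g = tgt G h"
  shows "L (cmp G g h) = cmp G (L g) (L h)"
  using assms by (simp add: to_loop_def src_cmp tgt_cmp cmp_closed cmp_assoc cmp_ginv_cancel)

lemma L_ginv: "g \<in> Mor G \<Longrightarrow> L (ginv G g) = ginv G (L g)"
  by (simp add: to_loop_def ginv_cmp cmp_closed src_cmp tgt_cmp cmp_assoc)

lemma L_Mor: "g \<in> Mor G \<Longrightarrow> L g \<in> Mor (isotropy G x)"
  using L_homset by simp

lemma I_x: "h \<in> homset G x x \<Longrightarrow> a \<in> I h \<Longrightarrow> a \<in> I x"
  using H.D_A[of h] by auto

lemma ux: "H.u x \<in> I x" "a \<in> I x \<Longrightarrow> H.u x * a = a" "a \<in> I x \<Longrightarrow> a * H.u x = a"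
  using H.u_D[of x] H.u_mult[of x] H.mult_u[of x] x_homset by simp_all

lemma uL: "g \<in> Mor G \<Longrightarrow> H.u (L g) \<in> I x"
  by (rule I_x[OF L_homset H.u_D[OF L_Mor]])

lemma subrng_Ix: "a \<in> I x \<Longrightarrow> c \<in> I x \<Longrightarrow> a + c \<in> I x" "a \<in> I x \<Longrightarrow> c \<in> I x \<Longrightarrow> a * c \<in> I x"
  using H.subrng_A by (auto simp: subrng_def)

context
  fixes y assumes y: "y \<in> Obj G"
begin

lemma phi_closed: "a \<in> I x \<Longrightarrow> \<phi> y a \<in> I y"
  and phi_add: "a \<in> I x \<Longrightarrow> c \<in> I x \<Longrightarrow> \<phi> y (a + c) = \<phi> y a + \<phi> y c"
  and phi_mult: "a \<in> I x \<Longrightarrow> c \<in> I x \<Longrightarrow> \<phi> y (a * c) = \<phi> y a * \<phi> y c"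
  and phi_inj: "a \<in> I x \<Longrightarrow> c \<in> I x \<Longrightarrow> \<phi> y a = \<phi> y c \<Longrightarrow> a = c"
  and gamma_phi: "a \<in> I x \<Longrightarrow> \<gamma> (\<tau> y) a = Some (\<phi> y a)"
  and pinv_phi: "a \<in> I x \<Longrightarrow> pinv (\<gamma> (\<tau> y)) (\<phi> y a) = Some a"
  using rng_iso_simps[OF iso[OF y]] rng_iso_inj[OF iso[OF y]] pinv_rng_iso(1)[OF iso[OF y]]
  by (simp_all add: \<phi>_def)

lemma phi_surj: "c \<in> I y \<Longrightarrow> \<exists>a\<in>I x. c = \<phi> y a"
  using rng_iso_surj[OF iso[OF y]] unfolding \<phi>_def by metis

lemma phi_one:
  assumes "c \<in> I y" shows "\<phi> y (H.u x) * c = c" "c * \<phi> y (H.u x) = c"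
proof -
  obtain a where "a \<in> I x" "c = \<phi> y a" using phi_surj[OF assms] by blast
  then show "\<phi> y (H.u x) * c = c" "c * \<phi> y (H.u x) = c" using ux by (simp_all flip: phi_mult)
qed

lemma I_absorb: "c \<in> I y \<Longrightarrow> r * c \<in> I y" "c \<in> I y \<Longrightarrow> c * r \<in> I y"
  using ideal[OF y] by (simp_all add: ideal_of_def)

text \<open>The identity of a two-sided ideal is central: its products with \<open>r\<close> on
  either side lie in the ideal, so each equals the product with the identity on both sides of
  \<open>r\<close>.\<close>

lemma phi_one_central: "\<phi> y (H.u x) * r = r * \<phi> y (H.u x)"
proof -
  have "\<phi> y (H.u x) * r = \<phi> y (H.u x) * r * \<phi> y (H.u x)"
    using phi_one(2)[OF I_absorb(2)] phi_closed ux by simp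
  also have "\<dots> = r * \<phi> y (H.u x)"
    using phi_one(1)[OF I_absorb(1)] phi_closed ux by (simp add: mult.assoc)
  finally show ?thesis .
qed

lemma psi_closed: "\<psi> y a \<in> I x" and phi_psi: "\<phi> y (\<psi> y a) = a * \<phi> y (H.u x)"
proof -
  obtain k where "k \<in> I x" "a * \<phi> y (H.u x) = \<phi> y k"
    using phi_surj I_absorb phi_closed ux by blast
  then show "\<psi> y a \<in> I x" "\<phi> y (\<psi> y a) = a * \<phi> y (H.u x)"
    by (simp_all add: \<psi>_def pinv_phi)
qed

lemma psi_phi: "a \<in> I x \<Longrightarrow> \<psi> y (\<phi> y a) = a"
  using phi_one(2)[OF phi_closed] by (simp add: \<psi>_def pinv_phi)

lemma psi_add: "\<psi> y (a + c) = \<psi> y a + \<psi> y c"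
  by (rule phi_inj) (simp_all add: psi_closed subrng_Ix phi_psi phi_add distrib_right)

lemma psi_mult: "\<psi> y (a * c) = \<psi> y a * \<psi> y c"
proof (rule phi_inj)
  have "a * \<phi> y (H.u x) * (c * \<phi> y (H.u x)) = a * (\<phi> y (H.u x) * c) * \<phi> y (H.u x)"
    by (simp only: mult.assoc)
  also have "\<dots> = a * c * \<phi> y (H.u x)"
    using phi_one(2)[OF phi_closed[OF ux(1)]] by (simp add: phi_one_central[of c] mult.assoc)
  finally show "\<phi> y (\<psi> y (a * c)) = \<phi> y (\<psi> y a * \<psi> y c)"
    by (simp add: psi_closed phi_psi phi_mult)
qed (simp_all add: psi_closed subrng_Ix)

end

lemma tmap_I: "g \<in> Mor G \<Longrightarrow> a \<in> I x \<Longrightarrow> H.tmap (L g) a \<in> I (L g)"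
  and tmap_Ix: "g \<in> Mor G \<Longrightarrow> a \<in> I x \<Longrightarrow> H.tmap (L g) a \<in> I x"
  using H.tmap_D[OF L_Mor] I_x[OF L_homset] by auto

text \<open>One formula for both cases of \<open>lifted\<close>: at an identity the loop is
  \<open>x\<close>, its map is the identity of \<open>I x\<close>, and \<open>\<psi>\<close>
  followed by \<open>\<phi>\<close> fixes \<open>I g\<close>.\<close>

lemma lifted_eq:
  assumes g: "g \<in> Mor G"
  shows "\<beta> g a = (if a \<in> I (src G g) \<and> \<psi> (src G g) a \<in> I (ginv G (L g))
    then Some (\<phi> (tgt G g) (H.val (L g) (\<psi> (src G g) a))) else None)"
proof (cases "g \<in> Obj G")
  case True
  then show ?thesis
    using x psi_closed[of g a] phi_psi[of g a] phi_one(2)[of g a] Obj_simps[OF x] H.val_Obj[of x "\<psi> g a"]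
    by (auto simp: lifted_def Obj_simps L_Obj pid_def Obj_isotropy)
next
  case False
  have s: "src G g \<in> Obj G" and t: "tgt G g \<in> Obj G" using g by auto
  have iso_L: "rng_iso (I (ginv G (L g))) (I (L g)) (\<gamma> (L g))"
    using H.rng_iso_val[OF L_Mor[OF g]] ginv_isotropy[OF L_homset[OF g]] by simp
  have val: "\<gamma> (L g) k = Some (H.val (L g) k)" "H.val (L g) k \<in> I x" if "k \<in> I (ginv G (L g))" for k
    using rng_iso_simps[OF iso_L] that I_x[OF L_homset[OF g]] by (auto simp: H.val_def)
  show ?thesis
  proof (cases "a \<in> I (src G g)")
    case a: True
    then obtain k where k: "k \<in> I x" "a = \<phi> (src G g) k" using phi_surj[OF s] by blast
    then show ?thesis
      using False a val rng_iso_simps(2)[OF iso_L]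
      by (auto simp: lifted_def map_comp_def pinv_phi[OF s] psi_phi[OF s] gamma_phi[OF t])
  next
    case a: False
    then show ?thesis
      using False pinv_rng_iso(2)[OF iso[OF s] a] by (simp add: lifted_def map_comp_def)
  qed
qed

lemma eps_phi_mult:
  assumes g: "g \<in> Mor G" and k: "k \<in> I x"
  shows "\<epsilon> g * \<phi> (tgt G g) k = \<phi> (tgt G g) (H.u (L g) * k)"
    "\<phi> (tgt G g) k * \<epsilon> g = \<phi> (tgt G g) (k * H.u (L g))"
  using g k uL[OF g] by (simp_all add: \<epsilon>_def phi_mult)

lemma eps_in: "g \<in> Mor G \<Longrightarrow> \<epsilon> g \<in> I (tgt G g)"
  unfolding \<epsilon>_def by (rule phi_closed[OF tgt_Obj uL])

text \<open>Centrality in \<open>I (tgt G g)\<close> is carried over from \<open>I x\<close>. A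
  general \<open>a\<close> is first replaced by its component \<open>a * ?w\<close> in that ideal,
  which changes neither product because \<open>?w\<close> fixes \<open>\<epsilon> g\<close>.\<close>

lemma eps_central:
  assumes g: "g \<in> Mor G" shows "\<epsilon> g * a = a * \<epsilon> g"
proof -
  let ?w = "\<phi> (tgt G g) (H.u x)"
  have t: "tgt G g \<in> Obj G" using g by simp
  have k: "\<phi> (tgt G g) (\<psi> (tgt G g) a) = a * ?w" "\<psi> (tgt G g) a \<in> I x"
    by (rule phi_psi[OF t], rule psi_closed[OF t])
  have "\<epsilon> g * a = \<epsilon> g * ?w * a" using phi_one(2)[OF t eps_in[OF g]] by simp
  also have "\<dots> = \<epsilon> g * (a * ?w)" by (simp add: mult.assoc phi_one_central[OF t, of a])
  also have "\<dots> = (a * ?w) * \<epsilon> g"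
    using eps_phi_mult[OF g k(2)] H.u_central[OF L_Mor[OF g] k(2)] by (simp add: k(1))
  also have "\<dots> = a * \<epsilon> g" using phi_one(1)[OF t eps_in[OF g]] by (simp add: mult.assoc)
  finally show ?thesis .
qed

text \<open>By globality no elements are lost in the composition, so the range is the full image of
  \<open>I (L g)\<close>. An element fixed by \<open>\<epsilon> g\<close> lies in
  \<open>I (tgt G g)\<close>, and its preimage in \<open>I x\<close> is fixed by the identity of
  \<open>I (L g)\<close>, hence lies in \<open>I (L g)\<close>.\<close>

lemma B_eq:
  assumes g: "g \<in> Mor G" shows "B g = {a. \<epsilon> g * a = a}"
proof -
  have s: "src G g \<in> Obj G" and t: "tgt G g \<in> Obj G" using g by auto
  have iso_L: "rng_iso (I (ginv G (L g))) (I (L g)) (\<gamma> (L g))"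
    using H.rng_iso_val[OF L_Mor[OF g]] ginv_isotropy[OF L_homset[OF g]] by simp
  have ginv_L: "ginv G (L g) \<in> homset G x x" using L_homset[OF g] by (simp add: homset_def)
  have "B g = \<phi> (tgt G g) ` I (L g)"
  proof (intro equalityI subsetI)
    fix c assume "c \<in> B g"
    then obtain a where "\<beta> g a = Some c" by (auto simp: ran_def)
    then show "c \<in> \<phi> (tgt G g) ` I (L g)"
      using rng_iso_simps(3)[OF iso_L] by (auto simp: lifted_eq[OF g] H.val_def split: if_splits)
  next
    fix c assume "c \<in> \<phi> (tgt G g) ` I (L g)"
    then obtain m where m: "m \<in> I (L g)" "c = \<phi> (tgt G g) m" by auto
    obtain k where k: "k \<in> I (ginv G (L g))" "m = H.val (L g) k"
      using rng_iso_surj[OF iso_L m(1)] unfolding H.val_def by blast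
    have kx: "k \<in> I x" using I_x[OF ginv_L k(1)] .
    have "\<beta> g (\<phi> (src G g) k) = Some c"
      using k m kx phi_closed[OF s kx] psi_phi[OF s kx] by (simp add: lifted_eq[OF g])
    then show "c \<in> B g" by (rule ranI)
  qed
  also have "\<dots> = {a. \<epsilon> g * a = a}"
  proof (intro equalityI subsetI)
    fix c assume "c \<in> \<phi> (tgt G g) ` I (L g)"
    then show "c \<in> {a. \<epsilon> g * a = a}"
      using eps_phi_mult(1)[OF g] I_x[OF L_homset[OF g]] H.u_mult[OF L_Mor[OF g]] by auto
  next
    fix c assume "c \<in> {a. \<epsilon> g * a = a}"
    then have c: "\<epsilon> g * c = c" by simp
    then have "c \<in> I (tgt G g)" using I_absorb(2)[OF t eps_in[OF g], of c] by simp
    then obtain k where k: "k \<in> I x" "c = \<phi> (tgt G g) k" using phi_surj[OF t] by blast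
    then have "\<phi> (tgt G g) (H.u (L g) * k) = \<phi> (tgt G g) k"
      using eps_phi_mult(1)[OF g] c by simp
    then have "H.u (L g) * k = k"
      using phi_inj[OF t] subrng_Ix(2)[OF uL[OF g] k(1)] k(1) by blast
    then have "k \<in> I (L g)"
      using H.D_absorb(2)[OF L_Mor[OF g] H.u_D[OF L_Mor[OF g]] k(1)] by simp
    then show "c \<in> \<phi> (tgt G g) ` I (L g)" using k by blast
  qed
  finally show ?thesis .
qed

sublocale total_partial_action G \<epsilon> b B \<beta>
proof
  show "finite (Mor G)" by (rule finite_Mor)
next
  fix g and a a' :: 'a assume g: "g \<in> Mor G"
  then have s: "src G g \<in> Obj G" and t: "tgt G g \<in> Obj G" by auto
  note Lg = L_Mor[OF g] L_homset[OF g]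
  show "\<epsilon> g * a = a * \<epsilon> g" by (rule eps_central[OF g])
  show "\<epsilon> g * \<epsilon> g = \<epsilon> g"
    using eps_phi_mult(1)[OF g uL[OF g]] H.u_mult[OF Lg(1) H.u_D[OF Lg(1)]] by (simp add: \<epsilon>_def)
  show "b g (a + a') = b g a + b g a'"
    using g by (simp add: b_def psi_add[OF s] H.tmap_add[OF Lg(1)] phi_add[OF t] psi_closed[OF s] tmap_Ix)
  show "b g (a * a') = b g a * b g a'"
    using g by (simp add: b_def psi_mult[OF s] H.tmap_mult[OF Lg(1)] phi_mult[OF t] psi_closed[OF s] tmap_Ix)
  show "\<epsilon> g * b g a = b g a"
    using eps_phi_mult(1)[OF g tmap_Ix[OF g psi_closed[OF s]]] H.u_mult[OF Lg(1) tmap_I[OF g psi_closed[OF s]]]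
    by (simp add: b_def)
  show "\<epsilon> (tgt G g) * \<epsilon> g = \<epsilon> g"
    using phi_one(1)[OF t eps_in[OF g]] t by (simp add: \<epsilon>_def[of "tgt G g"] L_Obj Obj_simps)
  show "B g = {a. \<epsilon> g * a = a}" by (rule B_eq[OF g])
  have g': "ginv G g \<in> Mor G" using g by simp
  have "is_rng_one (B (ginv G g)) (\<epsilon> (ginv G g))"
    unfolding is_rng_one_def B_eq[OF g']
  proof (intro conjI ballI)
    show "\<epsilon> (ginv G g) \<in> {a. \<epsilon> (ginv G g) * a = a}"
      using eps_phi_mult(1)[OF g' uL[OF g']] H.u_mult[OF L_Mor[OF g'] H.u_D[OF L_Mor[OF g']]]
      by (simp add: \<epsilon>_def)
    fix a assume a: "a \<in> {a. \<epsilon> (ginv G g) * a = a}"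
    then show "\<epsilon> (ginv G g) * a = a" by simp
    then show "a * \<epsilon> (ginv G g) = a" using eps_central[OF g', of a] by simp
  qed
  then have one: "rng_one (B (ginv G g)) = \<phi> (src G g) (H.u (ginv G (L g)))"
    using g rng_oneI by (auto simp: \<epsilon>_def L_ginv)
  \<comment> \<open>Under \<open>\<psi>\<close>, cutting down to the domain of
    \<open>\<beta> g\<close> becomes multiplication by the identity at the inverse loop, which is
    the cut built into \<open>H.tmap\<close>.\<close>
  have "\<psi> (src G g) (a * \<phi> (src G g) (H.u (ginv G (L g)))) = \<psi> (src G g) a * H.u (ginv G (L g))"
    using psi_mult[OF s] psi_phi[OF s] uL[OF g'] by (simp add: L_ginv[OF g])
  moreover have "a * \<phi> (src G g) (H.u (ginv G (L g))) \<in> I (src G g)"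
    using I_absorb(1)[OF s phi_closed[OF s uL[OF g']]] by (simp add: L_ginv[OF g])
  moreover have "\<psi> (src G g) a * H.u (ginv G (L g)) \<in> I (ginv G (L g))"
    using H.D_absorb(1)[OF L_Mor[OF g'] H.u_D[OF L_Mor[OF g']] psi_closed[OF s]] by (simp add: L_ginv[OF g])
  ultimately show "the (\<beta> g (a * rng_one (B (ginv G g)))) = b g a"
    unfolding one lifted_eq[OF g] by (simp add: b_def H.tmap_def ginv_isotropy[OF Lg(2)])
next
  fix y and a :: 'a assume y: "y \<in> Obj G"
  then show "b y a = \<epsilon> y * a"
    using H.tmap_Obj[of x "\<psi> y a"] psi_closed[OF y] x
    by (simp add: b_def \<epsilon>_def Obj_simps L_Obj Obj_isotropy phi_psi phi_one_central[OF y, of a])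
next
  fix g h and a :: 'a assume gh: "g \<in> Mor G" "h \<in> Mor G" "src G g = tgt G h"
  then have s: "src G h \<in> Obj G" "tgt G h \<in> Obj G" and k: "cmp G g h \<in> Mor G" by (auto simp: cmp_closed)
  \<comment> \<open>At the middle object \<open>\<psi>\<close> undoes \<open>\<phi>\<close>, which
    leaves a composite of two maps of the isotropy group.\<close>
  have "b g (b h a) = \<phi> (tgt G g) (H.tmap (L g) (H.tmap (L h) (\<psi> (src G h) a)))"
    using gh by (simp add: b_def psi_phi[OF s(2)] tmap_Ix psi_closed[OF s(1)])
  also have "\<dots> = \<phi> (tgt G g) (H.u (L g) * H.tmap (L (cmp G g h)) (\<psi> (src G h) a))"
    using H.tmap_tmap[OF L_Mor[OF gh(1)] L_Mor[OF gh(2)] _ psi_closed[OF s(1)]] L_homset gh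
    by (simp add: L_cmp homset_def)
  also have "\<dots> = \<epsilon> g * b (cmp G g h) a"
    using eps_phi_mult(1)[OF gh(1) tmap_Ix[OF k psi_closed[OF s(1)]]] gh
    by (simp add: b_def src_cmp tgt_cmp)
  finally show "b g (b h a) = \<epsilon> g * b (cmp G g h) a" .
qed

theorem morita_context_isotropy:
  fixes R S defines "R \<equiv> skew_ring G B \<beta>" and "S \<equiv> skew_ring (isotropy G x) B \<beta>"
  defines "U \<equiv> sub_bimodule R {r \<otimes>\<^bsub>R\<^esub> \<one>\<^bsub>S\<^esub> | r. r \<in> carrier R}"
    and "V \<equiv> sub_bimodule R {\<one>\<^bsub>S\<^esub> \<otimes>\<^bsub>R\<^esub> r | r. r \<in> carrier R}"
  shows "\<exists>\<mu> \<nu>.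
      (\<forall>u\<in>carrier U. \<forall>v\<in>carrier V. \<mu> (pure_tensor S U V u v) = u \<otimes>\<^bsub>R\<^esub> v)
    \<and> (\<forall>v\<in>carrier V. \<forall>u\<in>carrier U. \<nu> (pure_tensor R V U v u) = v \<otimes>\<^bsub>R\<^esub> u)
    \<and> morita_context R S U V \<mu> \<nu>
    \<and> \<mu> ` carrier (tensor S U V) = carrier R
    \<and> \<nu> ` carrier (tensor R V U) = carrier S"
proof -
  interpret corner: corner_ring "skew_ring G B \<beta>" "local_one {x}" "skew_ring (isotropy G x) B \<beta>"
    by (rule corner_ring_isotropy[OF x])
  have "\<exists>g\<in>homset G x y. \<epsilon> g = \<epsilon> y" if y: "y \<in> Obj G" for y
    using y by (intro bexI[of _ "\<tau> y"]) (simp_all add: \<epsilon>_def L_tau L_Obj Obj_simps homset_def)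
  then have "Idl\<^bsub>skew_ring G B \<beta>\<^esub> {local_one {x}} = carrier (skew_ring G B \<beta>)"
    by (rule Idl_local_one[OF x])
  from corner.morita_context[OF this] show ?thesis
    unfolding U_def V_def R_def S_def corner.one_S .
qed

end

section \<open>Globality as a condition on the datum, and the theorem\<close>

lemma pinv_pid: "pinv (pid X) = pid X"
  by (auto simp: fun_eq_iff pinv_def pid_def ran_def)

text \<open>For \<open>y \<noteq> x\<close> the morphism \<open>\<tau> y\<close> is not an identity and its loop is \<open>x\<close>, so
  \<open>\<beta> (\<tau> y)\<close> is the restriction of \<open>\<gamma> (\<tau> y)\<close> to \<open>I x\<close>, and globality of \<open>\<beta>\<close> becomes
  a condition on \<open>I\<close>.\<close>

lemma tau_global_lifted:
  assumes G: "groupoid G" and x: "x \<in> Obj G" and \<tau>: "transversal G x \<tau>"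
    and datum: "tau_datum G x \<tau> A I \<gamma>"
    and glob: "tau_global G x \<tau> (\<lambda>g. ran (lifted G \<tau> I \<gamma> g))" and y: "y \<in> Obj G"
  shows "I (ginv G (\<tau> y)) = I x" "I (\<tau> y) = I y"
proof -
  interpret groupoid G by (rule G)
  have tau: "\<tau> z \<in> Mor G" "src G (\<tau> z) = x" "tgt G (\<tau> z) = z" if "z \<in> Obj G" for z
    using \<tau> that by (auto simp: transversal_def homset_def)
  have tau_x: "\<tau> x = x" using \<tau> by (simp add: transversal_def)
  have iso: "rng_iso (I (ginv G (\<tau> y))) (I (\<tau> y)) (\<gamma> (\<tau> y))" and \<gamma>x: "\<gamma> x = pid (I x)"
    and sub: "I (ginv G (\<tau> y)) \<subseteq> I x"
    using datum y tau_x by (auto simp: tau_datum_def ideal_of_def)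
  have dom: "dom (\<gamma> (\<tau> y)) = I (ginv G (\<tau> y))" and ran: "ran (\<gamma> (\<tau> y)) = I (\<tau> y)"
    using iso by (simp_all add: rng_iso_def)
  have ran_Obj: "ran (lifted G \<tau> I \<gamma> z) = I z" if "z \<in> Obj G" for z
    using that by (auto simp: lifted_def pid_def ran_def)
  have "I (ginv G (\<tau> y)) = I x \<and> I (\<tau> y) = I y"
  proof (cases "y = x")
    case True
    then show ?thesis using Obj_simps[OF x] tau_x by simp
  next
    case False
    have notObj: "\<tau> y \<notin> Obj G" "ginv G (\<tau> y) \<notin> Obj G"
      using False Obj_simps(2,3)[of "\<tau> y"] Obj_simps(2,3)[of "ginv G (\<tau> y)"] tau[OF y] by auto
    have loops: "to_loop G \<tau> (\<tau> y) = x" "to_loop G \<tau> (ginv G (\<tau> y)) = x"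
      using tau[OF y] Obj_simps[OF x] cmp_src[of x] cmp_tgt[of "ginv G (\<tau> y)"]
      by (simp_all add: to_loop_def tau_x)
    \<comment> \<open>Clause (e) puts the domain of \<open>\<gamma> (\<tau> y)\<close> inside
      \<open>I x\<close>, so the restriction changes nothing.\<close>
    have "lifted G \<tau> I \<gamma> (\<tau> y) = \<gamma> (\<tau> y)"
    proof
      fix a
      have "\<gamma> (\<tau> y) a = None" if "a \<notin> I x" using that sub dom by blast
      then show "lifted G \<tau> I \<gamma> (\<tau> y) a = \<gamma> (\<tau> y) a"
        using notObj tau[OF y] loops by (simp add: lifted_def tau_x \<gamma>x pinv_pid) (simp add: map_comp_def pid_def)
    qed
    moreover have "ran (lifted G \<tau> I \<gamma> (ginv G (\<tau> y))) = I (ginv G (\<tau> y))"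
    proof -
      \<comment> \<open>The values of the inverse bijection lie in \<open>I x\<close>, and the two
        outer factors are both the identity of \<open>I x\<close>.\<close>
      have "lifted G \<tau> I \<gamma> (ginv G (\<tau> y)) = pinv (\<gamma> (\<tau> y))"
      proof
        fix c
        have "a \<in> I x" if "pinv (\<gamma> (\<tau> y)) c = Some a" for a
        proof -
          have "c \<in> I (\<tau> y)" using that pinv_rng_iso(2)[OF iso, of c] by fastforce
          then obtain a' where "a' \<in> I (ginv G (\<tau> y))" "c = the (\<gamma> (\<tau> y) a')"
            using rng_iso_surj[OF iso] by blast
          then show ?thesis using that pinv_rng_iso(1)[OF iso] sub by auto
        qed
        then show "lifted G \<tau> I \<gamma> (ginv G (\<tau> y)) c = pinv (\<gamma> (\<tau> y)) c"
          using notObj tau[OF y] loops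
          by (simp add: lifted_def tau_x \<gamma>x) (auto simp: map_comp_def pid_def split: option.splits)
      qed
      moreover have "ran (pinv (\<gamma> (\<tau> y))) = I (ginv G (\<tau> y))"
      proof (intro equalityI subsetI)
        fix a assume "a \<in> ran (pinv (\<gamma> (\<tau> y)))"
        then obtain c where c: "pinv (\<gamma> (\<tau> y)) c = Some a" by (auto simp: ran_def)
        then have "c \<in> I (\<tau> y)" using pinv_rng_iso(2)[OF iso, of c] by fastforce
        then obtain a' where "a' \<in> I (ginv G (\<tau> y))" "c = the (\<gamma> (\<tau> y) a')"
          using rng_iso_surj[OF iso] by blast
        then show "a \<in> I (ginv G (\<tau> y))" using c pinv_rng_iso(1)[OF iso] by simp
      next
        fix a assume "a \<in> I (ginv G (\<tau> y))"
        then have "pinv (\<gamma> (\<tau> y)) (the (\<gamma> (\<tau> y) a)) = Some a" by (rule pinv_rng_iso(1)[OF iso])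
        then show "a \<in> ran (pinv (\<gamma> (\<tau> y)))" by (rule ranI)
      qed
      ultimately show ?thesis by simp
    qed
    moreover have "ran (lifted G \<tau> I \<gamma> (ginv G (\<tau> y))) = ran (lifted G \<tau> I \<gamma> x)"
      "ran (lifted G \<tau> I \<gamma> (\<tau> y)) = ran (lifted G \<tau> I \<gamma> y)"
      using glob y unfolding tau_global_def by blast+
    ultimately show ?thesis using ran ran_Obj[OF y] ran_Obj[OF x] by simp
  qed
  then show "I (ginv G (\<tau> y)) = I x" "I (\<tau> y) = I y" by simp_all
qed

theorem theorem7p2:
  fixes G :: "'g category" and x :: 'g and \<tau> :: "'g \<Rightarrow> 'g"
    and I B :: "'g \<Rightarrow> 'a::ring set" and \<gamma> \<beta> :: "'g \<Rightarrow> 'a \<rightharpoonup> 'a"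
    and R S :: "('g \<Rightarrow> 'a) ring"
    and U V :: "('g \<Rightarrow> 'a, 'g \<Rightarrow> 'a, 'g \<Rightarrow> 'a) bimodule"
  assumes "groupoid G" and "finite (Mor G)" and "connected_groupoid G"
    and "x \<in> Obj G" and "transversal G x \<tau>"
    and "tau_datum G x \<tau> UNIV I \<gamma>"
    and "\<beta> = lifted G \<tau> I \<gamma>" and "B = (\<lambda>g. ran (\<beta> g))"
    and "tau_global G x \<tau> B" and "gamma_unital G x I \<gamma>"
    and "internal_direct_sum UNIV (Obj G) I" and "internal_direct_sum UNIV (Obj G) B"
    and "R = skew_ring G B \<beta>" and "S = skew_ring (isotropy G x) B \<beta>"
    and "U = sub_bimodule R {r \<otimes>\<^bsub>R\<^esub> \<one>\<^bsub>S\<^esub> | r. r \<in> carrier R}"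
    and "V = sub_bimodule R {\<one>\<^bsub>S\<^esub> \<otimes>\<^bsub>R\<^esub> r | r. r \<in> carrier R}"
  shows "\<exists>\<mu> \<nu>.
      (\<forall>u\<in>carrier U. \<forall>v\<in>carrier V. \<mu> (pure_tensor S U V u v) = u \<otimes>\<^bsub>R\<^esub> v)
    \<and> (\<forall>v\<in>carrier V. \<forall>u\<in>carrier U. \<nu> (pure_tensor R V U v u) = v \<otimes>\<^bsub>R\<^esub> u)
    \<and> morita_context R S U V \<mu> \<nu>
    \<and> \<mu> ` carrier (tensor S U V) = carrier R
    \<and> \<nu> ` carrier (tensor R V U) = carrier S"
proof -
  interpret groupoid G by (rule assms(1))
  have glob: "I (ginv G (\<tau> y)) = I x" "I (\<tau> y) = I y" if "y \<in> Obj G" for y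
    using tau_global_lifted[OF assms(1,4-6) _ that] assms(7-9) by simp_all
  have action: "partial_action (isotropy G x) (I x) I \<gamma>"
    and unital: "\<And>h. h \<in> homset G x x \<Longrightarrow> \<exists>e. is_rng_one (I h) e \<and> (\<forall>r\<in>I x. e * r = r * e)"
    using assms(10)
    by (auto simp: gamma_unital_def unital_partial_group_action_def partial_group_action_def)
  have "unital_partial_action (isotropy G x) (I x) I \<gamma>"
    unfolding unital_partial_action_def unital_partial_action_axioms_def
    using action unital by (simp add: partial_action_def[of "isotropy G x"])
  \<comment> \<open>By \<open>glob\<close> the isomorphisms of clause (b) run from all of
    \<open>I x\<close> onto all of \<open>I y\<close>, as the locale requires.\<close>
  then have "lifted_action G x \<tau> I \<gamma>"
    using assms(1,2,4-6) glob by (auto simp: lifted_action_def lifted_action_axioms_def tau_datum_def)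
  then interpret lifted_action G x \<tau> I \<gamma> .
  show ?thesis
    unfolding assms(15,16) unfolding assms(13,14) unfolding assms(8) unfolding assms(7)
    by (rule morita_context_isotropy)
qed

end
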